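(* Let $n\ge2$ and let $K\subset\mathbb{R}^n$ be a convex body with $C^3$-smooth boundary. For any $v\in\mathbb{S}^{n-1}$, let $I_v(t)$ denote the isoperimetric ratio of $K^v(t)$, $t>0$. Then there is an orthonormal basis $e_1,e_2,\dots,e_n$ of $\mathbb{R}^n$ such that $I'_{e_i}(1)=0$ for every $i=1,\dots,n$.
   Context: The isoperimetric ratio of an $n$-dimensional convex body $K$ is $I(K)=\frac{\mathrm{vol}(K)}{(\mathrm{surf}(K))^{n/(n-1)}}\cdot\frac{(\mathrm{surf}(B^n))^{n/(n-1)}}{\mathrm{vol}(B^n)}$, where $\mathrm{vol}$ is $n$-dimensional volume, $\mathrm{surf}$ is surface area and $B^n$ is the Euclidean unit ball centered at the origin. For $v\in\mathbb{S}^{n-1}$, $H$ is the hyperplane through the center of mass of $K$ with normal vector $v$; for $t>0$, $a^v_t:\mathbb{R}^n\to\mathbb{R}^n$ is the orthogonal affinity of ratio $t$ with $H$ as its fixed hyperplane (it fixes $H$ pointwise and multiplies the signed distance from $H$ by $t$ along the direction $v$); and $K^v(t)=a^v_t(K)$. $I'_v$ denotes the derivative with respect to $t$. *)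

theory Defs
  imports "HOL-Analysis.Analysis"
begin

definition convex_body :: "(real ^ 'n) set \<Rightarrow> bool" where
  "convex_body K \<longleftrightarrow> compact K \<and> convex K \<and> interior K \<noteq> {}"

abbreviation vol :: "(real ^ 'n) set \<Rightarrow> real" where
  "vol K \<equiv> measure lebesgue K"

(* Surface area in the sense of Minkowski: the right derivative at 0 of the volume of the
   outer parallel body K + r * cball 0 1.  The limit exists for every convex body
   (Steiner's formula). *)
definition parallel_body :: "(real ^ 'n) set \<Rightarrow> real \<Rightarrow> (real ^ 'n) set" where
  "parallel_body K r = {x + y | x y. x \<in> K \<and> y \<in> cball 0 r}"

definition surf :: "(real ^ 'n) set \<Rightarrow> real" where
  "surf K = Lim (at_right 0) (\<lambda>r. (vol (parallel_body K r) - vol K) / r)"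

definition isoperimetric_ratio :: "(real ^ 'n) set \<Rightarrow> real" where
  "isoperimetric_ratio K =
     (let p = real CARD('n) / (real CARD('n) - 1);
          B = cball (0 :: real ^ 'n) 1
      in vol K / surf K powr p * (surf B powr p / vol B))"

definition center_of_mass :: "(real ^ 'n) set \<Rightarrow> real ^ 'n" where
  "center_of_mass K = integral K (\<lambda>x. x) /\<^sub>R vol K"

(* For a unit vector v: the hyperplane through c with normal v is fixed pointwise, and the
   signed distance from it, (x - c) \<bullet> v, is multiplied by t. *)
definition orthogonal_affinity :: "real ^ 'n \<Rightarrow> real ^ 'n \<Rightarrow> real \<Rightarrow> real ^ 'n \<Rightarrow> real ^ 'n" where
  "orthogonal_affinity c v t x = x + ((t - 1) * ((x - c) \<bullet> v)) *\<^sub>R v"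

definition stretch :: "(real ^ 'n) set \<Rightarrow> real ^ 'n \<Rightarrow> real \<Rightarrow> (real ^ 'n) set" where
  "stretch K v t = orthogonal_affinity (center_of_mass K) v t ` K"

(* Intended for open U only, where differentiable_on and the Frechet derivative at a point of
   U are unambiguous; axis i 1 is the i-th standard unit vector. *)
primrec C_k_on :: "nat \<Rightarrow> (real ^ 'n \<Rightarrow> real) \<Rightarrow> (real ^ 'n) set \<Rightarrow> bool" where
  "C_k_on 0 f U \<longleftrightarrow> continuous_on U f"
| "C_k_on (Suc k) f U \<longleftrightarrow>
     f differentiable_on U \<and>
     (\<forall>i. C_k_on k (\<lambda>x. frechet_derivative f (at x) (axis i 1)) U)"

(* The boundary is an embedded C^k hypersurface: locally the zero set of a C^k function
   whose differential does not vanish. *)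
definition C_k_boundary :: "nat \<Rightarrow> (real ^ 'n) set \<Rightarrow> bool" where
  "C_k_boundary k K \<longleftrightarrow>
     (\<forall>p \<in> frontier K. \<exists>U f. open U \<and> p \<in> U \<and> C_k_on k f U \<and>
        (\<forall>x \<in> U. frechet_derivative f (at x) \<noteq> (\<lambda>h. 0)) \<and>
        frontier K \<inter> U = {x \<in> U. f x = 0})"

end

theory Submission
  imports Defs
begin

text \<open>Write \<open>p x = sweep K x\<close> for the volume that \<open>K\<close> gains when it is pushed along the vector \<open>x\<close>. This function is
continuous and positively homogeneous of degree one. The unit ball is, up to a factor, a weighted
average of the segments from \<open>0\<close> to \<open>x\<close>, with any rotation invariant weight \<open>\<phi>\<close>; since the first variation of
volume is additive over segments, the surface area of \<open>K\<close> is a constant times \<open>\<integral> \<phi> p\<close>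
(\<open>ex_surf_eq_integral_sweep\<close>). The proof replaces the average by finite sums of segments that enclose balls of nearly equal
radii (\<open>ex_quadrature\<close>, \<open>tendsto_ball_growth\<close>).

This formula transforms well. If \<open>A\<close> is linear with volume factor \<open>t\<close>, then the surface area of \<open>A ` K\<close> is the same
constant times \<open>t\<^sup>2 \<integral> \<phi>(A x) p(x)\<close>, so that the map acts on the smooth weight alone and one may differentiate
under the integral sign. For the orthogonal affinity of ratio \<open>t\<close> along the unit vector \<open>v\<close> the squared norm of \<open>A x\<close> is
\<open>(norm x)\<^sup>2 + (t\<^sup>2 - 1) (x \<bullet> v)\<^sup>2\<close>, whence the derivative of the surface area at \<open>t = 1\<close> is
\<open>2 S + Q v\<close>, where \<open>S\<close> is the surface area of \<open>K\<close> and \<open>Q\<close> is a quadratic form in \<open>v\<close>. The sum of \<open>Q\<close> over an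
orthonormal basis comes from the derivative along dilations, and homogeneity of \<open>p\<close> gives the value
\<open>- (n + 1) S\<close>.

The volume is multiplied by \<open>t\<close>, so the isoperimetric ratio is stationary at \<open>t = 1\<close> if and only if the derivative
of the surface area is \<open>(n - 1) S / n\<close>, that is \<open>Q v = - (n + 1) S / n\<close>: the value of \<open>Q\<close> at \<open>v\<close> has to
be its mean over an orthonormal basis. Rotations in coordinate planes produce an orthonormal basis at all of
whose members a given quadratic form takes its mean value (\<open>ex_orthonormal_equalising\<close>).\<close>

section \<open>Invariance of Lebesgue measure under rotations\<close>

text \<open>The theorems on linear change of variables go through triangular matrices and so presuppose a linear
order on the index type. Every finite type has an ordered copy, the initial segment of
the naturals of the same size; rotation invariance is carried over from that copy by renaming
coordinates.\<close>
typedef ('a::finite) index = "{..<CARD('a)}"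
  by (rule exI[of _ 0]) simp

instantiation index :: (finite) linorder
begin
definition less_eq_index :: "'a index \<Rightarrow> 'a index \<Rightarrow> bool"
  where "i \<le> j \<longleftrightarrow> Rep_index i \<le> Rep_index j"
definition less_index :: "'a index \<Rightarrow> 'a index \<Rightarrow> bool"
  where "i < j \<longleftrightarrow> Rep_index i < Rep_index j"
instance
  by standard (auto simp: less_eq_index_def less_index_def Rep_index_inject)
end

instance index :: (finite) finite
proof
  show "finite (UNIV :: 'a index set)"
    by (simp add: type_definition.univ[OF type_definition_index])
qed

instance index :: (finite) wellorder
proof
  fix P :: "'a index \<Rightarrow> bool" and a
  assume step: "\<And>x. (\<And>y. y < x \<Longrightarrow> P y) \<Longrightarrow> P x"
  show "P a"
    by (induction "Rep_index a" arbitrary: a rule: less_induct)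
      (metis less_index_def step)
qed

lemma ex_bij_index: "\<exists>\<pi> :: 'n::finite index \<Rightarrow> 'n. bij \<pi>"
proof -
  have "card (UNIV :: 'n index set) = card (UNIV :: 'n set)"
    by (simp add: type_definition.card[OF type_definition_index])
  then show ?thesis by (meson finite_same_card_bij finite)
qed

text \<open>Renaming coordinates turns boxes into boxes of equal volume, and values on boxes determine
Lebesgue measure.\<close>
lemma measure_relabel_image:
  fixes \<pi> :: "'m::finite \<Rightarrow> 'n::finite" and S :: "(real^'n) set"
  assumes "bij \<pi>" and "compact S"
  shows "measure lebesgue ((\<lambda>x. \<chi> j. x $ \<pi> j) ` S :: (real^'m) set) = measure lebesgue S"
proof -
  define R :: "real^'n \<Rightarrow> real^'m" where "R = (\<lambda>x. \<chi> j. x $ \<pi> j)"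
  define R' :: "real^'m \<Rightarrow> real^'n" where "R' = (\<lambda>y. \<chi> i. y $ inv \<pi> i)"
  have inv: "R' (R x) = x" "R (R' y) = y" for x y
    using assms(1) by (auto simp: R_def R'_def vec_eq_iff bij_is_inj bij_is_surj surj_f_inv_f)
  have cont: "continuous_on UNIV R" "continuous_on UNIV R'"
    unfolding R_def R'_def by (intro continuous_intros continuous_on_vec_lambda; simp)+
  have vim: "R' ` S = R -` S" "R ` T = R' -` T" for S T
    using inv by (auto simp: image_iff) metis+
  have [measurable]: "R' \<in> borel_measurable borel"
    using cont by (simp add: borel_measurable_continuous_onI)
  have "lborel = distr (lborel :: (real^'m) measure) borel R'"
  proof (rule lborel_eqI)
    fix l u :: "real^'n"
    assume lu: "\<And>b. b \<in> Basis \<Longrightarrow> l \<bullet> b \<le> u \<bullet> b"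
    have le: "l $ i \<le> u $ i" for i
      using lu[of "axis i 1"] by (simp add: inner_axis)
    have box: "R' -` box l u = box (R l) (R u)"
    proof -
      have "y $ inv \<pi> i = y $ j" if "i = \<pi> j" for y :: "real^'m" and i j
        using that assms(1) by (simp add: bij_is_inj)
      then show ?thesis
        using bij_is_surj[OF assms(1)] unfolding R_def R'_def
        by (auto simp: mem_box_cart) (metis surjD)+
    qed
    have prodcart: "(\<Prod>b\<in>Basis. x \<bullet> b) = (\<Prod>i\<in>UNIV. x $ i)" for x :: "real^'k::finite"
    proof -
      have Basis: "(Basis :: (real^'k) set) = (\<lambda>i. axis i 1) ` UNIV"
        by (auto simp: Basis_vec_def)
      have "inj (\<lambda>i::'k. axis i (1::real))"
        by (auto simp: inj_on_def axis_eq_axis)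
      then show ?thesis
        unfolding Basis by (subst prod.reindex) (auto simp: inner_axis)
    qed
    have "emeasure (distr lborel borel R') (box l u) = emeasure lborel (box (R l) (R u))"
      by (simp add: emeasure_distr box)
    also have "\<dots> = ennreal (\<Prod>b\<in>Basis. (R u - R l) \<bullet> b)"
    proof (rule emeasure_lborel_box)
      fix b :: "real^'m" assume "b \<in> Basis"
      then obtain j where "b = axis j 1" by (auto simp: Basis_vec_def)
      then show "R l \<bullet> b \<le> R u \<bullet> b" using le by (simp add: R_def inner_axis)
    qed
    also have "(\<Prod>b\<in>Basis. (R u - R l) \<bullet> b) = (\<Prod>b\<in>Basis. (u - l) \<bullet> b)"
      unfolding prodcart
      by (simp add: R_def) (use prod.reindex_bij_betw[OF assms(1), of "\<lambda>i. u $ i - l $ i"] in simp)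
    finally show "emeasure (distr lborel borel R') (box l u) = (\<Prod>b\<in>Basis. (u - l) \<bullet> b)"
      by simp
  qed simp
  then have "emeasure lborel S = emeasure (distr (lborel :: (real^'m) measure) borel R') S"
    by simp
  also have "\<dots> = emeasure lborel (R ` S)"
    using assms(2) by (simp add: emeasure_distr vim borel_compact)
  finally have "measure lborel S = measure lborel (R ` S)"
    by (simp add: measure_def)
  moreover have "compact (R ` S)"
    using assms(2) cont by (meson compact_continuous_image continuous_on_subset top_greatest)
  ultimately show ?thesis
    using assms(2) by (simp add: R_def borel_compact)
qed

lemma measure_orthogonal_image_finite:
  fixes f :: "real^'n \<Rightarrow> real^'n"
  assumes "orthogonal_transformation f" and "S \<in> lmeasurable"
  shows "measure lebesgue (f ` S) = measure lebesgue S"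
proof -
  obtain \<pi> :: "'n index \<Rightarrow> 'n" where \<pi>: "bij \<pi>" using ex_bij_index by blast
  define R :: "real^'n \<Rightarrow> real^'n index" where "R = (\<lambda>x. \<chi> j. x $ \<pi> j)"
  define R' :: "real^'n index \<Rightarrow> real^'n" where "R' = (\<lambda>y. \<chi> i. y $ inv \<pi> i)"
  have inv: "R' (R x) = x" "R (R' y) = y" for x y
    using \<pi> by (auto simp: R_def R'_def vec_eq_iff bij_is_inj bij_is_surj surj_f_inv_f)
  have lin: "linear R" "linear R'"
    by (auto intro!: linearI simp: R_def R'_def vec_eq_iff)
  have linf: "linear f" using assms(1) orthogonal_transformation_linear by blast
  have inner: "R x \<bullet> R y = x \<bullet> y" for x y
    unfolding inner_vec_def R_def
    using sum.reindex_bij_betw[OF \<pi>, of "\<lambda>i. x $ i \<bullet> y $ i"] by simp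
  have "orthogonal_transformation (R \<circ> f \<circ> R')"
    using assms(1) lin linf inv inner unfolding orthogonal_transformation_def
    by (auto intro!: linear_compose simp: o_assoc) metis
  have box: "measure lebesgue (f ` cbox a b) = 1 * measure lebesgue (cbox a b)" for a b
  proof -
    have cR: "compact (R ` cbox a b)"
      by (intro compact_continuous_image linear_continuous_on)
        (use lin in \<open>auto simp: linear_linear\<close>)
    have cf: "compact (f ` cbox a b)"
      by (intro compact_continuous_image linear_continuous_on)
        (use linf in \<open>auto simp: linear_linear\<close>)
    have "measure lebesgue (f ` cbox a b) = measure lebesgue (R ` f ` cbox a b)"
      unfolding R_def by (rule measure_relabel_image[OF \<pi> cf, symmetric])
    also have "R ` f ` cbox a b = (R \<circ> f \<circ> R') ` R ` cbox a b"
      by (simp add: image_comp o_def inv)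
    also have "measure lebesgue \<dots> = measure lebesgue (R ` cbox a b)"
      by (rule measure_orthogonal_image[OF \<open>orthogonal_transformation (R \<circ> f \<circ> R')\<close> lmeasurable_compact[OF cR]])
    also have "\<dots> = measure lebesgue (cbox a b)"
      unfolding R_def by (rule measure_relabel_image[OF \<pi>]) simp
    finally show ?thesis by simp
  qed
  show ?thesis
    using measure_linear_sufficient[OF linf assms(2) box] by simp
qed

section \<open>Linear changes of variables\<close>

text \<open>Recording the factor \<open>m\<close> itself, in place of the absolute value of a determinant, makes composition
immediate and spares every determinant computation below.\<close>
definition scales_volume :: "(real^'n \<Rightarrow> real^'n) \<Rightarrow> real \<Rightarrow> bool" where
  "scales_volume f m \<longleftrightarrow> linear f \<and> bij f \<and> 0 < m \<and>
     (\<forall>S\<in>lmeasurable. f ` S \<in> lmeasurable \<and> measure lebesgue (f ` S) = m * measure lebesgue S)"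

lemma scales_volume_orthogonal:
  fixes f :: "real^'n \<Rightarrow> real^'n"
  assumes "orthogonal_transformation f"
  shows "scales_volume f 1"
proof -
  have lin: "linear f" using assms orthogonal_transformation_linear by blast
  have "f ` S \<in> lmeasurable" if "S \<in> lmeasurable" for S
  proof -
    have "measure lebesgue (f ` cbox a b) = 1 * measure lebesgue (cbox a b)" for a b
      using measure_orthogonal_image_finite[OF assms, of "cbox a b"] by simp
    then show ?thesis using measure_linear_sufficient[OF lin that] by blast
  qed
  then show ?thesis
    using lin assms measure_orthogonal_image_finite[OF assms] orthogonal_transformation_bij
    by (auto simp: scales_volume_def)
qed

lemma scales_volume_compose:
  assumes "scales_volume f m" and "scales_volume g k"
  shows "scales_volume (f \<circ> g) (m * k)"
proof -
  have "(f \<circ> g) ` S = f ` (g ` S)" for S by (simp add: image_comp)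
  then show ?thesis
    using assms unfolding scales_volume_def
    by (metis (no_types, lifting) bij_comp linear_compose mult.assoc mult_pos_pos)
qed

lemma scales_volume_stretch:
  fixes m :: "'n::finite \<Rightarrow> real"
  assumes "\<And>i. m i > 0"
  shows "scales_volume (\<lambda>x::real^'n. \<chi> i. m i * x $ i) (prod m UNIV)"
proof -
  have "bij (\<lambda>x::real^'n. \<chi> i. m i * x $ i)"
  proof (rule bijI')
    show "((\<chi> i. m i * x $ i) = (\<chi> i. m i * y $ i)) = (x = y)" for x y :: "real^'n"
      using assms by (auto simp: vec_eq_iff less_imp_neq[THEN not_sym])
    show "\<exists>x. y = (\<chi> i. m i * x $ i)" for y :: "real^'n"
      using assms
      by (intro exI[of _ "\<chi> i. y $ i / m i"]) (auto simp: vec_eq_iff less_imp_neq[THEN not_sym])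
  qed
  moreover have "linear (\<lambda>x::real^'n. \<chi> i. m i * x $ i)"
    by (auto intro!: linearI simp: vec_eq_iff algebra_simps)
  moreover have "prod m UNIV > 0" using assms by (simp add: prod_pos)
  ultimately show ?thesis
    by (auto simp: scales_volume_def measurable_stretch measure_stretch)
qed

lemma scales_volume_scaleR:
  assumes "t > 0"
  shows "scales_volume (\<lambda>x::real^'n. t *\<^sub>R x) (t ^ CARD('n))"
proof -
  have "(\<lambda>x::real^'n. \<chi> i. t * x $ i) = (\<lambda>x. t *\<^sub>R x)"
    by (auto simp: vec_eq_iff)
  then show ?thesis using scales_volume_stretch[of "\<lambda>_::'n. t"] assms by simp
qed

text \<open>A rotation moves the axis \<open>v\<close> to a coordinate axis, where the map multiplies one coordinate by \<open>t\<close>.\<close>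
lemma scales_volume_axial:
  fixes v :: "real^'n"
  assumes "norm v = 1" and "t > 0"
  shows "scales_volume (\<lambda>x. x + ((t - 1) * (x \<bullet> v)) *\<^sub>R v) t"
proof -
  define k :: 'n where "k = undefined"
  define D :: "real^'n \<Rightarrow> real^'n" where "D = (\<lambda>x. \<chi> i. (if i = k then t else 1) * x $ i)"
  have D: "scales_volume D t"
    using scales_volume_stretch[of "\<lambda>i. if i = k then t else 1"] \<open>t > 0\<close> by (simp add: D_def)
  have Dx: "D x = x + ((t - 1) * (x \<bullet> axis k 1)) *\<^sub>R axis k 1" for x
    by (simp add: D_def vec_eq_iff inner_axis) (simp add: axis_def algebra_simps)
  have "norm (axis k 1 :: real^'n) = norm v" using assms by (simp add: norm_axis_1)
  then obtain f :: "real^'n \<Rightarrow> real^'n"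
    where f: "orthogonal_transformation f" "f (axis k 1) = v"
    by (rule orthogonal_transformation_exists)
  define g where "g = inv f"
  have g: "orthogonal_transformation g" "\<And>x. f (g x) = x"
    using f(1) by (auto simp: g_def orthogonal_transformation_inv orthogonal_transformation_surj surj_f_inv_f)
  have lf: "linear f" using f(1) orthogonal_transformation_linear by blast
  have "g x \<bullet> axis k 1 = x \<bullet> v" for x
    by (metis f g(2) orthogonal_transformation_def)
  then have "f (D (g x)) = x + ((t - 1) * (x \<bullet> v)) *\<^sub>R v" for x
    using lf g(2) f(2) by (simp add: Dx linear_add linear_scale)
  then have "(\<lambda>x. x + ((t - 1) * (x \<bullet> v)) *\<^sub>R v) = f \<circ> (D \<circ> g)"
    by auto
  then show ?thesis
    using scales_volume_compose[OF scales_volume_orthogonal[OF f(1)]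
        scales_volume_compose[OF D scales_volume_orthogonal[OF g(1)]]] by simp
qed

lemma integrable_compact_support:
  fixes g :: "'a::euclidean_space \<Rightarrow> real"
  assumes "continuous_on UNIV g" and "\<And>x. norm x > R \<Longrightarrow> g x = 0"
  shows "integrable lborel g"
proof -
  have "integrable lborel (\<lambda>x. indicator (cball 0 R) x *\<^sub>R g x)"
    using assms(1) by (intro borel_integrable_compact) (auto intro: continuous_on_subset)
  moreover have "(\<lambda>x. indicator (cball 0 R) x *\<^sub>R g x) = g"
    using assms(2) by (auto simp: indicator_def fun_eq_iff)
  ultimately show ?thesis by simp
qed

lemma integral_compact_support_cbox:
  fixes g :: "'a::euclidean_space \<Rightarrow> real"
  assumes "continuous_on UNIV g" and "\<And>x. norm x > R \<Longrightarrow> g x = 0" and "cball 0 R \<subseteq> cbox a b"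
  shows "integral UNIV g = integral (cbox a b) g"
proof (rule integral_unique)
  show "(g has_integral integral (cbox a b) g) UNIV"
  proof (rule has_integral_on_superset)
    show "(g has_integral integral (cbox a b) g) (cbox a b)"
      by (intro integrable_integral integrable_continuous continuous_on_subset[OF assms(1)]) auto
    show "g x = 0" if "x \<notin> cbox a b" for x
      using that assms(2)[of x] assms(3) by (meson mem_cball_0 not_le subsetD)
  qed simp
qed

text \<open>Both \<open>lborel\<close> and its image under \<open>f\<close>, reweighted by \<open>m\<close>, give the same mass to every box.\<close>
lemma integral_scales_volume:
  fixes g :: "real^'n \<Rightarrow> real"
  assumes sv: "scales_volume f m"
    and g: "continuous_on UNIV g" "\<And>x. norm x > R \<Longrightarrow> g x = 0"
  shows "integral UNIV g = m * integral UNIV (\<lambda>x. g (f x))"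
proof -
  have lin: "linear f" and bij: "bij f" and m: "m > 0"
    and meas: "\<And>S. S \<in> lmeasurable \<Longrightarrow> f ` S \<in> lmeasurable \<and> measure lebesgue (f ` S) = m * measure lebesgue S"
    using sv by (auto simp: scales_volume_def)
  have contf: "continuous_on S f" for S
    using lin linear_continuous_on linear_linear by blast
  then have [measurable]: "f \<in> borel_measurable borel"
    by (simp add: borel_measurable_continuous_onI)
  have "linear (inv f)"
    using lin bij by (simp add: inj_linear_imp_inv_linear bij_is_inj)
  then have continv: "continuous_on S (inv f)" for S
    using linear_continuous_on linear_linear by blast
  have "lborel = density (distr lborel borel f) (\<lambda>_. ennreal m)"
  proof (rule lborel_eqI)
    fix l u :: "real^'n"
    assume lu: "\<And>b. b \<in> Basis \<Longrightarrow> l \<bullet> b \<le> u \<bullet> b"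
    have vim: "f -` box l u = inv f ` box l u"
      using bij by (simp add: bij_vimage_eq_inv_image)
    have "bounded (inv f ` box l u)"
      by (rule bounded_subset[of "inv f ` cbox l u"])
        (use box_subset_cbox[of l u] in
          \<open>auto intro!: compact_imp_bounded compact_continuous_image continv\<close>)
    moreover have "open (f -` box l u)"
      by (rule open_vimage[OF open_box contf])
    ultimately have lm: "f -` box l u \<in> lmeasurable"
      using vim by (simp add: lmeasurable_open)
    have "f ` (f -` box l u) = box l u"
      using bij by (simp add: bij_is_surj image_vimage_eq)
    then have "m * measure lebesgue (f -` box l u) = measure lborel (box l u)"
      using meas[OF lm] by simp
    then have "m * measure lborel (f -` box l u) = (\<Prod>b\<in>Basis. (u - l) \<bullet> b)"
      using lu \<open>open (f -` box l u)\<close> by (simp add: borel_open measure_lborel_box)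
    moreover have "emeasure lborel (f -` box l u) = measure lborel (f -` box l u)"
    proof (rule emeasure_eq_ennreal_measure)
      show "emeasure lborel (f -` box l u) \<noteq> top"
        using emeasure_bounded_finite[of "f -` box l u"] vim \<open>bounded (inv f ` box l u)\<close> by auto
    qed
    ultimately show "emeasure (density (distr lborel borel f) (\<lambda>_. ennreal m)) (box l u)
        = ennreal (\<Prod>b\<in>Basis. (u - l) \<bullet> b)"
      using m by (simp add: emeasure_density_const emeasure_distr ennreal_mult'[symmetric])
  qed simp
  moreover have gb [measurable]: "g \<in> borel_measurable borel"
    using g(1) by (simp add: borel_measurable_continuous_onI)
  ultimately have "integral\<^sup>L lborel g = integral\<^sup>L (density (distr lborel borel f) (\<lambda>_. ennreal m)) g"
    by simp
  also have "\<dots> = m * integral\<^sup>L lborel (\<lambda>x. g (f x))"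
    using m by (simp add: integral_density integral_distr)
  finally have eq: "integral\<^sup>L lborel g = m * integral\<^sup>L lborel (\<lambda>x. g (f x))" .
  obtain B where B: "B > 0" "\<And>x. norm (inv f x) \<le> B * norm x"
    using \<open>linear (inv f)\<close> linear_bounded_pos by blast
  have "g (f x) = 0" if "norm x > B * R" for x
  proof (rule g(2))
    have "B * R < B * norm (f x)"
      using B(2)[of "f x"] that bij by (simp add: bij_is_inj)
    then show "R < norm (f x)" using B(1) by simp
  qed
  moreover have "continuous_on UNIV (\<lambda>x. g (f x))"
    using g(1) contf by (rule continuous_on_compose2) simp
  ultimately have "integrable lborel (\<lambda>x. g (f x))"
    by (intro integrable_compact_support)
  then show ?thesis
    using eq integrable_compact_support[OF g] by (simp add: integral_lborel)
qed

section \<open>The volume swept by a translation\<close>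
lemma compact_set_plus:
  fixes A B :: "'a::real_normed_vector set"
  assumes "compact A" "compact B"
  shows "compact (A + B)"
proof -
  have "A + B = (\<Union>x\<in>A. \<Union>y\<in>B. {x + y})" by (auto simp: set_plus_def)
  then show ?thesis using compact_sums'[OF assms] by simp
qed

lemma vol_mono_compact:
  assumes "compact A" "compact B" "A \<subseteq> B"
  shows "vol A \<le> vol B"
  using assms by (intro measure_mono_fmeasurable) (auto simp: lmeasurable_compact fmeasurableD)

lemma vol_outer_continuous:
  fixes K :: "(real^'n) set"
  assumes "compact K" and "\<epsilon> > 0"
  obtains \<delta> where "\<delta> > 0"
    "\<And>L. compact L \<Longrightarrow> L \<subseteq> K + cball 0 \<delta> \<Longrightarrow> vol L < vol K + \<epsilon>"
proof -
  have "K \<in> sets lebesgue" using assms(1) by (simp add: lmeasurable_compact fmeasurableD)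
  then obtain U where U: "open U" "K \<subseteq> U" "U - K \<in> lmeasurable" "emeasure lebesgue (U - K) < ennreal \<epsilon>"
    using sets_lebesgue_outer_open[OF _ \<open>\<epsilon> > 0\<close>] by blast
  obtain \<delta> where \<delta>: "\<delta> > 0" "(\<Union>x\<in>K. cball x \<delta>) \<subseteq> U"
    using compact_subset_open_imp_cball_epsilon_subset[OF assms(1) U(1,2)] by blast
  have "vol L < vol K + \<epsilon>" if L: "compact L" "L \<subseteq> K + cball 0 \<delta>" for L
  proof -
    have "K + cball 0 \<delta> \<subseteq> (\<Union>x\<in>K. cball x \<delta>)"
      by (auto simp: set_plus_def dist_norm)
    then have "L \<subseteq> K \<union> (U - K)" using L \<delta> by blast
    then have "vol L \<le> measure lebesgue (K \<union> (U - K))"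
      using L U(3) assms(1)
      by (intro measure_mono_fmeasurable fmeasurable.Un) (auto simp: lmeasurable_compact fmeasurableD)
    also have "\<dots> \<le> vol K + measure lebesgue (U - K)"
      using U(3) assms(1) by (intro measure_Un_le) (auto simp: lmeasurable_compact fmeasurableD)
    also have "measure lebesgue (U - K) < \<epsilon>"
      using U(3,4) by (simp add: emeasure_eq_measure2 ennreal_less_iff)
    finally show ?thesis by simp
  qed
  then show thesis using that \<delta>(1) by blast
qed

text \<open>The volume gained when \<open>K\<close> is pushed along \<open>w\<close>. For convex \<open>K\<close> this equals \<open>norm w\<close> times the
\<open>(n - 1)\<close>-dimensional volume of the projection of \<open>K\<close> along \<open>w\<close>, i.e. it is the support function of
the projection body of \<open>K\<close>; this form needs only \<open>n\<close>-dimensional measure.\<close>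
definition sweep :: "(real^'n) set \<Rightarrow> real^'n \<Rightarrow> real" where
  "sweep K w = vol (K + closed_segment 0 w) - vol K"

lemma subset_plus_segment: "K \<subseteq> K + closed_segment 0 (w::'a::real_normed_vector)"
proof
  fix x assume "x \<in> K"
  then have "x + 0 \<in> K + closed_segment 0 w" by (intro set_plus_intro) auto
  then show "x \<in> K + closed_segment 0 w" by simp
qed

lemma mem_plus_segment:
  fixes w :: "'a::real_normed_vector"
  assumes "r \<ge> 0"
  shows "x \<in> K + closed_segment 0 (r *\<^sub>R w) \<longleftrightarrow> (\<exists>s. 0 \<le> s \<and> s \<le> r \<and> x - s *\<^sub>R w \<in> K)"
proof
  assume "x \<in> K + closed_segment 0 (r *\<^sub>R w)"
  then obtain k u where "k \<in> K" "0 \<le> u" "u \<le> 1" "x = k + (u * r) *\<^sub>R w"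
    by (auto simp: set_plus_def in_segment)
  then show "\<exists>s. 0 \<le> s \<and> s \<le> r \<and> x - s *\<^sub>R w \<in> K"
    using assms by (intro exI[of _ "u * r"]) (auto simp: mult_left_le_one_le)
next
  assume "\<exists>s. 0 \<le> s \<and> s \<le> r \<and> x - s *\<^sub>R w \<in> K"
  then obtain s where s: "0 \<le> s" "s \<le> r" "x - s *\<^sub>R w \<in> K" by blast
  have "s *\<^sub>R w \<in> closed_segment 0 (r *\<^sub>R w)"
  proof (cases "r = 0")
    case False
    then show ?thesis using s assms
      by (auto simp: in_segment intro!: exI[of _ "s / r"])
  qed (use s in auto)
  then have "(x - s *\<^sub>R w) + s *\<^sub>R w \<in> K + closed_segment 0 (r *\<^sub>R w)"
    using s by (intro set_plus_intro)
  then show "x \<in> K + closed_segment 0 (r *\<^sub>R w)" by simp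
qed

lemma compact_plus_segment:
  "compact K \<Longrightarrow> compact (K + closed_segment 0 (w::'a::real_normed_vector))"
  by (simp add: compact_set_plus)

lemma convex_plus_segment:
  "convex K \<Longrightarrow> convex (K + closed_segment 0 (w::'a::real_normed_vector))"
  by (simp add: convex_set_plus)

lemma sweep_nonneg: "compact K \<Longrightarrow> 0 \<le> sweep K w"
  unfolding sweep_def
  using vol_mono_compact[OF _ compact_plus_segment subset_plus_segment] by simp

text \<open>On each line parallel to \<open>w\<close> a convex \<open>K\<close> is an interval, and pushing only prolongs it at its far
end. The part gained between times \<open>a\<close> and \<open>a + b\<close> is therefore the part gained up to time \<open>b\<close>, moved
by \<open>a *\<^sub>R w\<close>.\<close>
lemma sweep_add:
  assumes "compact K" "convex K" "a \<ge> 0" "b \<ge> 0"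
  shows "sweep K ((a + b) *\<^sub>R w) = sweep K (a *\<^sub>R w) + sweep K (b *\<^sub>R w)"
proof -
  define D where "D r = K + closed_segment 0 (r *\<^sub>R w)" for r
  have D: "x \<in> D r \<longleftrightarrow> (\<exists>s. 0 \<le> s \<and> s \<le> r \<and> x - s *\<^sub>R w \<in> K)" if "r \<ge> 0" for x r
    using mem_plus_segment[OF that] by (simp add: D_def)
  have lm: "D r \<in> lmeasurable" "K \<in> lmeasurable" for r
    using assms(1) by (auto simp: D_def lmeasurable_compact compact_plus_segment)
  have sub: "D a \<subseteq> D (a + b)" "K \<subseteq> D b"
    using assms(3,4) D subset_plus_segment[of K] by (force, auto simp: D_def)
  \<comment> \<open>\<open>D r\<close> is \<open>K\<close> pushed up to time \<open>r\<close>. Convexity enters in the second inclusion only: a point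
    between two points of \<open>K\<close> lies in \<open>K\<close>.\<close>
  have "D (a + b) - D a = (+) (a *\<^sub>R w) ` (D b - K)"
  proof (intro equalityI subsetI)
    fix x assume x: "x \<in> D (a + b) - D a"
    then obtain s where s: "0 \<le> s" "s \<le> a + b" "x - s *\<^sub>R w \<in> K"
      using D[of "a + b"] assms(3,4) by auto
    have "a < s" using x s D[OF assms(3)] by force
    then have "x - a *\<^sub>R w \<in> D b"
      using s D[OF assms(4)] by (auto simp: algebra_simps intro!: exI[of _ "s - a"])
    moreover have "x - a *\<^sub>R w \<notin> K" using x D[OF assms(3)] assms(3) by auto
    ultimately show "x \<in> (+) (a *\<^sub>R w) ` (D b - K)"
      by (intro image_eqI[of _ _ "x - a *\<^sub>R w"]) auto
  next
    fix x assume "x \<in> (+) (a *\<^sub>R w) ` (D b - K)"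
    then obtain y where x: "x = a *\<^sub>R w + y" and y: "y \<in> D b" "y \<notin> K" by auto
    then obtain s where s: "0 \<le> s" "s \<le> b" "y - s *\<^sub>R w \<in> K"
      using D[OF assms(4)] by auto
    have "x \<in> D (a + b)"
      using s assms(3,4) D[of "a + b"]
      by (auto simp: x algebra_simps intro!: exI[of _ "a + s"])
    moreover have "x \<notin> D a"
    proof
      assume "x \<in> D a"
      then obtain u where u: "0 \<le> u" "u \<le> a" "x - u *\<^sub>R w \<in> K" using D[OF assms(3)] by auto
      define c where "c = a - u"
      have c: "c \<ge> 0" "y + c *\<^sub>R w \<in> K" using u by (auto simp: c_def x algebra_simps)
      show False
      proof (cases "c + s = 0")
        case True
        then have "c = 0" using c s by simp
        then show ?thesis using c y(2) by simp
      next
        case False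
        then have "c / (c + s) + s / (c + s) = 1" by (simp flip: add_divide_distrib)
        then have "(c / (c + s)) *\<^sub>R (y - s *\<^sub>R w) + (s / (c + s)) *\<^sub>R (y + c *\<^sub>R w) \<in> K"
          using c s by (intro convexD[OF assms(2)]) auto
        moreover have "(c / (c + s)) *\<^sub>R (y - s *\<^sub>R w) + (s / (c + s)) *\<^sub>R (y + c *\<^sub>R w)
            = (c / (c + s) + s / (c + s)) *\<^sub>R y"
          by (simp add: algebra_simps)
        ultimately show False
          using y(2) \<open>c / (c + s) + s / (c + s) = 1\<close> by simp
      qed
    qed
    ultimately show "x \<in> D (a + b) - D a" by blast
  qed
  then have "measure lebesgue (D (a + b) - D a) = measure lebesgue (D b - K)"
    by (simp add: measure_translation)
  then have "vol (D (a + b)) - vol (D a) = vol (D b) - vol K"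
    using sub lm by (simp add: measurable_measure_Diff fmeasurableD)
  then show ?thesis by (simp add: sweep_def D_def)
qed

lemma additive_nonneg_imp_linear:
  fixes P :: "real \<Rightarrow> real"
  assumes add: "\<And>a b. a \<ge> 0 \<Longrightarrow> b \<ge> 0 \<Longrightarrow> P (a + b) = P a + P b"
    and nonneg: "\<And>a. a \<ge> 0 \<Longrightarrow> P a \<ge> 0" and "r \<ge> 0"
  shows "P r = r * P 1"
proof -
  have mono: "P a \<le> P b" if "0 \<le> a" "a \<le> b" for a b
    using add[of a "b - a"] nonneg[of "b - a"] that by simp
  have P0: "P 0 = 0" using add[of 0 0] by simp
  have mult: "P (real n * a) = real n * P a" if "a \<ge> 0" for n a
    by (induction n) (use that P0 in \<open>auto simp: algebra_simps add\<close>)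
  \<comment> \<open>Both \<open>P (n * r)\<close> and \<open>n * r * P 1\<close> lie between consecutive multiples of \<open>P 1\<close>.\<close>
  have bound: "real n * \<bar>P r - r * P 1\<bar> \<le> P 1" for n
  proof -
    define k where "k = nat \<lfloor>real n * r\<rfloor>"
    have k: "real k \<le> real n * r" "real n * r \<le> real (Suc k)"
      using \<open>r \<ge> 0\<close> by (auto simp: k_def floor_less_cancel) linarith
    have "real k * P 1 \<le> real n * P r"
      using mono[OF _ k(1)] mult[of 1 k] mult[OF \<open>r \<ge> 0\<close>, of n] by simp
    moreover have "real n * P r \<le> real (Suc k) * P 1"
      using mono[OF _ k(2)] mult[of 1 "Suc k"] mult[OF \<open>r \<ge> 0\<close>, of n] \<open>r \<ge> 0\<close> by simp
    moreover have "real k * P 1 \<le> (real n * r) * P 1" "(real n * r) * P 1 \<le> real (Suc k) * P 1"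
      using k nonneg[of 1] by (auto intro: mult_right_mono)
    ultimately have "\<bar>real n * P r - real n * r * P 1\<bar> \<le> P 1"
      by (simp add: algebra_simps abs_le_iff)
    then show ?thesis by (simp add: abs_mult_pos' algebra_simps flip: right_diff_distrib)
  qed
  show ?thesis
  proof (rule ccontr)
    assume "P r \<noteq> r * P 1"
    then have "\<bar>P r - r * P 1\<bar> > 0" by simp
    then obtain n where "P 1 < real n * \<bar>P r - r * P 1\<bar>" using reals_Archimedean3 by blast
    then show False using bound[of n] by simp
  qed
qed

lemma sweep_scaleR:
  assumes "compact K" "convex K" "r \<ge> 0"
  shows "sweep K (r *\<^sub>R w) = r * sweep K w"
  using additive_nonneg_imp_linear[of "\<lambda>r. sweep K (r *\<^sub>R w)" r] assms sweep_add[OF assms(1,2)]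
    sweep_nonneg[OF assms(1)] by simp

text \<open>If nothing were gained along \<open>w\<close>, nothing would be gained along its multiples either, yet a
translation longer than the diameter produces a disjoint copy of \<open>K\<close>.\<close>
lemma sweep_pos:
  assumes "compact K" "convex K" "vol K > 0" "w \<noteq> 0"
  shows "sweep K w > 0"
proof (rule ccontr)
  assume "\<not> sweep K w > 0"
  then have s0: "sweep K w = 0" using sweep_nonneg[OF assms(1), of w] by simp
  obtain B where B: "\<And>x. x \<in> K \<Longrightarrow> norm x \<le> B" "B > 0"
    using compact_imp_bounded[OF assms(1)] bounded_pos by blast
  define r where "r = 3 * B / norm w"
  have r: "r \<ge> 0" "norm (r *\<^sub>R w) = 3 * B" using B(2) assms(4) by (auto simp: r_def)
  define K' where "K' = (+) (r *\<^sub>R w) ` K"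
  have "K \<inter> K' = {}"
  proof -
    have False if "x \<in> K" "x = r *\<^sub>R w + y" "y \<in> K" for x y
    proof -
      have "r *\<^sub>R w = x - y" using that by simp
      then have "norm (r *\<^sub>R w) \<le> norm x + norm y" using norm_triangle_ineq4 by metis
      then show False using r(2) B(1)[of x] B(1)[of y] B(2) that by linarith
    qed
    then show ?thesis by (auto simp: K'_def)
  qed
  moreover have K': "compact K'" using assms(1) by (simp add: K'_def compact_translation)
  ultimately have "vol (K \<union> K') = vol K + vol K'"
    using assms(1) by (intro measure_Un3[THEN trans]) (auto simp: lmeasurable_compact)
  moreover have "vol K' = vol K" by (simp add: K'_def measure_translation)
  moreover have "vol (K \<union> K') \<le> vol (K + closed_segment 0 (r *\<^sub>R w))"
  proof (intro vol_mono_compact compact_plus_segment compact_Un)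
    have "K' \<subseteq> K + closed_segment 0 (r *\<^sub>R w)"
      unfolding K'_def by (auto intro: set_plus_intro simp: add.commute[of "r *\<^sub>R w"])
    then show "K \<union> K' \<subseteq> K + closed_segment 0 (r *\<^sub>R w)" using subset_plus_segment by blast
  qed (use assms(1) K' in auto)
  moreover have "sweep K (r *\<^sub>R w) = 0" using sweep_scaleR[OF assms(1,2) r(1)] s0 by simp
  ultimately show False using assms(3) by (simp add: sweep_def)
qed

text \<open>Both volumes in the definition of \<^const>\<open>sweep\<close> are upper semicontinuous under small enlargements of the
body, and monotone; this makes their difference continuous under enlargement.\<close>
lemma sweep_perturb:
  fixes K :: "(real^'n) set"
  assumes "compact K" "\<epsilon> > 0"
  obtains \<delta> where "\<delta> > 0"
    "\<And>L. compact L \<Longrightarrow> K \<subseteq> L \<Longrightarrow> L \<subseteq> K + cball 0 \<delta> \<Longrightarrow> \<bar>sweep L w - sweep K w\<bar> < \<epsilon>"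
proof -
  obtain \<delta>1 where \<delta>1: "\<delta>1 > 0"
    "\<And>L. compact L \<Longrightarrow> L \<subseteq> K + cball 0 \<delta>1 \<Longrightarrow> vol L < vol K + \<epsilon>"
    using vol_outer_continuous[OF assms] by blast
  obtain \<delta>2 where \<delta>2: "\<delta>2 > 0"
    "\<And>L. compact L \<Longrightarrow> L \<subseteq> K + closed_segment 0 w + cball 0 \<delta>2 \<Longrightarrow>
       vol L < vol (K + closed_segment 0 w) + \<epsilon>"
    using vol_outer_continuous[OF compact_plus_segment[OF assms(1)] assms(2)] by blast
  have "\<bar>sweep L w - sweep K w\<bar> < \<epsilon>"
    if L: "compact L" "K \<subseteq> L" "L \<subseteq> K + cball 0 (min \<delta>1 \<delta>2)" for L
  proof -
    have "L \<subseteq> K + cball 0 \<delta>1"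
      by (rule order_trans[OF L(3) set_plus_mono2]) auto
    then have 1: "vol L < vol K + \<epsilon>" using \<delta>1(2) L(1) by blast
    have "L \<subseteq> K + cball 0 \<delta>2"
      by (rule order_trans[OF L(3) set_plus_mono2]) auto
    then have "L + closed_segment 0 w \<subseteq> (K + cball 0 \<delta>2) + closed_segment 0 w"
      by (intro set_plus_mono2) auto
    also have "\<dots> = K + closed_segment 0 w + cball 0 \<delta>2" by (simp add: ac_simps)
    finally have 2: "vol (L + closed_segment 0 w) < vol (K + closed_segment 0 w) + \<epsilon>"
      using \<delta>2(2) compact_plus_segment[OF L(1)] by blast
    have 3: "vol K \<le> vol L" using vol_mono_compact assms(1) L by blast
    have "vol (K + closed_segment 0 w) \<le> vol (L + closed_segment 0 w)"
      using assms(1) L by (intro vol_mono_compact compact_plus_segment set_plus_mono2) auto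
    then show ?thesis using 1 2 3 by (simp add: sweep_def abs_less_iff)
  qed
  then show thesis using that[of "min \<delta>1 \<delta>2"] \<delta>1(1) \<delta>2(1) by simp
qed

lemma plus_segment_subset_cball:
  assumes "norm w \<le> \<delta>"
  shows "K + closed_segment 0 w \<subseteq> K + cball 0 (\<delta>::real)"
proof (rule set_plus_mono2)
  show "closed_segment 0 w \<subseteq> cball 0 \<delta>"
    using assms order_trans[OF norm_ge_zero assms]
    by (intro closed_segment_subset) auto
qed simp

text \<open>Pushing along \<open>w1\<close> and then along \<open>w2\<close> covers more than pushing along \<open>w1 + w2\<close>, but the second push
then starts from an enlarged body. Shrinking both vectors by a factor \<open>r\<close> makes this enlargement
harmless, and homogeneity removes the factor.\<close>
lemma sweep_subadditive:
  fixes K :: "(real^'n) set"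
  assumes "compact K" "convex K"
  shows "sweep K (w1 + w2) \<le> sweep K w1 + sweep K w2"
proof (rule field_le_epsilon)
  fix \<epsilon> :: real assume "\<epsilon> > 0"
  obtain \<delta> where \<delta>: "\<delta> > 0"
    "\<And>L. compact L \<Longrightarrow> K \<subseteq> L \<Longrightarrow> L \<subseteq> K + cball 0 \<delta> \<Longrightarrow> \<bar>sweep L w2 - sweep K w2\<bar> < \<epsilon>"
    using sweep_perturb[OF assms(1) \<open>\<epsilon> > 0\<close>] by blast
  \<comment> \<open>The summand \<open>\<delta>\<close> in the denominator covers the case \<open>w1 = 0\<close>.\<close>
  define r where "r = \<delta> / (\<delta> + norm w1)"
  have r: "r > 0" "r * norm w1 \<le> \<delta>"
    using \<delta>(1) by (auto simp: r_def field_simps add_pos_nonneg)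
  define L where "L = K + closed_segment 0 (r *\<^sub>R w1)"
  have L: "compact L" "convex L" "K \<subseteq> L" "L \<subseteq> K + cball 0 \<delta>"
    using assms r
    by (auto simp: L_def compact_plus_segment convex_plus_segment
        intro!: subset_plus_segment plus_segment_subset_cball)
  have "K + closed_segment 0 (r *\<^sub>R (w1 + w2)) \<subseteq> L + closed_segment 0 (r *\<^sub>R w2)"
  proof
    fix x assume "x \<in> K + closed_segment 0 (r *\<^sub>R (w1 + w2))"
    then obtain s where s: "0 \<le> s" "s \<le> r" "x - s *\<^sub>R (w1 + w2) \<in> K"
      unfolding mem_plus_segment[OF less_imp_le[OF r(1)]] by blast
    then have "x - s *\<^sub>R w2 \<in> L"
      using mem_plus_segment[of r "x - s *\<^sub>R w2" K w1] r(1)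
      by (auto simp: L_def algebra_simps intro!: exI[of _ s])
    then show "x \<in> L + closed_segment 0 (r *\<^sub>R w2)"
      using mem_plus_segment[of r] r(1) s by auto
  qed
  then have "vol (K + closed_segment 0 (r *\<^sub>R (w1 + w2))) \<le> vol (L + closed_segment 0 (r *\<^sub>R w2))"
    using assms L by (intro vol_mono_compact compact_plus_segment)
  then have "sweep K (r *\<^sub>R (w1 + w2)) \<le> sweep K (r *\<^sub>R w1) + sweep L (r *\<^sub>R w2)"
    by (simp add: sweep_def L_def)
  then have "r * sweep K (w1 + w2) \<le> r * (sweep K w1 + sweep L w2)"
    using r(1) L assms by (simp add: sweep_scaleR algebra_simps del: scaleR_add_right)
  then have "sweep K (w1 + w2) \<le> sweep K w1 + sweep L w2" using r(1) by simp
  also have "\<dots> \<le> sweep K w1 + sweep K w2 + \<epsilon>" using \<delta>(2)[OF L(1,3,4)] by linarith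
  finally show "sweep K (w1 + w2) \<le> sweep K w1 + sweep K w2 + \<epsilon>" .
qed

text \<open>By subadditivity the oscillation of \<^const>\<open>sweep\<close> is governed by its values near the origin.\<close>
lemma uniformly_continuous_sweep:
  fixes K :: "(real^'n) set"
  assumes "compact K" "convex K"
  shows "uniformly_continuous_on UNIV (sweep K)"
  unfolding uniformly_continuous_on_def
proof (intro allI impI)
  fix \<epsilon> :: real assume "\<epsilon> > 0"
  obtain \<delta> where \<delta>: "\<delta> > 0" "\<And>L. compact L \<Longrightarrow> L \<subseteq> K + cball 0 \<delta> \<Longrightarrow> vol L < vol K + \<epsilon>"
    using vol_outer_continuous[OF assms(1) \<open>\<epsilon> > 0\<close>] by blast
  have small: "sweep K w < \<epsilon>" if "norm w \<le> \<delta>" for w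
    using \<delta>(2)[OF compact_plus_segment plus_segment_subset_cball[OF that]] assms(1)
    by (simp add: sweep_def)
  have diff: "sweep K x - sweep K y \<le> sweep K (x - y)" for x y
    using sweep_subadditive[OF assms, of "x - y" y] by simp
  have "dist (sweep K x') (sweep K x) < \<epsilon>" if "dist x' x < \<delta>" for x x'
    using diff[of x x'] diff[of x' x] small[of "x - x'"] small[of "x' - x"] that
    by (simp add: dist_norm norm_minus_commute abs_less_iff)
  then show "\<exists>\<delta>>0. \<forall>x\<in>UNIV. \<forall>x'\<in>UNIV. dist x' x < \<delta> \<longrightarrow> dist (sweep K x') (sweep K x) < \<epsilon>"
    using \<delta>(1) by blast
qed

lemma sweep_translation: "sweep ((+) a ` K) w = sweep K w"
proof -
  have "(+) a ` K + closed_segment 0 w = (+) a ` (K + closed_segment 0 w)"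
    by (auto simp: set_plus_def image_iff) (metis add.assoc)+
  then show ?thesis by (simp add: sweep_def measure_translation)
qed

lemma sweep_linear_image:
  assumes "scales_volume f m" "compact K"
  shows "sweep (f ` K) (f w) = m * sweep K w"
proof -
  have "linear f" using assms(1) by (simp add: scales_volume_def)
  then have "f ` closed_segment 0 w = closed_segment 0 (f w)"
    by (metis closed_segment_linear_image linear_0)
  moreover have "f ` (K + closed_segment 0 w) = f ` K + f ` closed_segment 0 w"
    using \<open>linear f\<close> by (fastforce simp: set_plus_def linear_add intro!: image_eqI[OF linear_add[symmetric]])
  ultimately have "f ` K + closed_segment 0 (f w) = f ` (K + closed_segment 0 w)" by simp
  then show ?thesis
    using assms by (simp add: sweep_def scales_volume_def lmeasurable_compact compact_plus_segment
        right_diff_distrib)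
qed

section \<open>Outer parallel bodies and sums of segments\<close>
lemma compact_sum_segments:
  fixes w :: "'i \<Rightarrow> 'a::real_normed_vector"
  shows "finite F \<Longrightarrow> compact (\<Sum>i\<in>F. closed_segment 0 (w i))"
  by (induction F rule: finite_induct) (auto simp: compact_set_plus set_zero)

lemma convex_sum_segments:
  fixes w :: "'i \<Rightarrow> 'a::real_normed_vector"
  shows "finite F \<Longrightarrow> convex (\<Sum>i\<in>F. closed_segment 0 (w i))"
  by (induction F rule: finite_induct) (auto simp: convex_set_plus set_zero)

lemma sum_segments_subset_cball:
  fixes w :: "'i \<Rightarrow> 'a::real_normed_vector"
  assumes "finite F" "(\<Sum>i\<in>F. norm (w i)) \<le> \<delta>"
  shows "(\<Sum>i\<in>F. closed_segment 0 (w i)) \<subseteq> cball 0 \<delta>"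
proof
  fix x assume "x \<in> (\<Sum>i\<in>F. closed_segment 0 (w i))"
  then obtain s where s: "x = sum s F" "\<forall>i\<in>F. s i \<in> closed_segment 0 (w i)"
    using assms(1) by (auto simp: set_sum_alt)
  have "norm (s i) \<le> norm (w i)" if "i \<in> F" for i
    using s(2) that segment_bound1[of "s i" 0 "w i"] by simp
  then have "norm x \<le> (\<Sum>i\<in>F. norm (w i))"
    unfolding s(1) by (intro order_trans[OF norm_sum] sum_mono)
  then show "x \<in> cball 0 \<delta>" using assms(2) by simp
qed

lemma zero_in_sum_segments:
  fixes w :: "'i \<Rightarrow> 'a::real_normed_vector"
  assumes "finite F"
  shows "0 \<in> (\<Sum>i\<in>F. closed_segment 0 (w i))"
  using assms by (auto simp: set_sum_alt intro!: exI[of _ "\<lambda>_. 0"])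

text \<open>Adding the segments one at a time, the last one contributes exactly \<open>r\<close> times the sweep of a
body that tends to \<open>K\<close>. So the first variation of volume in the direction of a sum of segments is
additive; this is the linearity that surface area inherits below.\<close>
lemma tendsto_growth_sum_segments:
  fixes K :: "(real^'n) set" and w :: "'i \<Rightarrow> real^'n"
  assumes K: "compact K" "convex K" and "finite F"
  shows "((\<lambda>r. (vol (K + (\<Sum>i\<in>F. closed_segment 0 (r *\<^sub>R w i))) - vol K) / r)
           \<longlongrightarrow> (\<Sum>i\<in>F. sweep K (w i))) (at_right 0)"
  using \<open>finite F\<close>
proof (induction F rule: finite_induct)
  case empty
  then show ?case by simp
next
  case (insert j F)
  define Z where "Z r = (\<Sum>i\<in>F. closed_segment 0 (r *\<^sub>R w i))" for r
  have Z: "compact (K + Z r)" "convex (K + Z r)" "K \<subseteq> K + Z r" for r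
  proof -
    show "compact (K + Z r)" "convex (K + Z r)"
      using K insert.hyps(1) unfolding Z_def
      by (auto intro!: compact_set_plus convex_set_plus compact_sum_segments convex_sum_segments)
    show "K \<subseteq> K + Z r"
      using set_zero_plus2[OF zero_in_sum_segments[OF insert.hyps(1)]] by (simp add: Z_def add.commute)
  qed
  have "((\<lambda>r. sweep (K + Z r) (w j)) \<longlongrightarrow> sweep K (w j)) (at_right 0)"
  proof (rule tendstoI)
    fix \<epsilon> :: real assume "\<epsilon> > 0"
    obtain \<delta> where \<delta>: "\<delta> > 0"
      "\<And>L. compact L \<Longrightarrow> K \<subseteq> L \<Longrightarrow> L \<subseteq> K + cball 0 \<delta> \<Longrightarrow> \<bar>sweep L (w j) - sweep K (w j)\<bar> < \<epsilon>"
      using sweep_perturb[OF K(1) \<open>\<epsilon> > 0\<close>] by blast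
    define C where "C = (\<Sum>i\<in>F. norm (w i))"
    have "C \<ge> 0" by (simp add: C_def sum_nonneg)
    have "eventually (\<lambda>r. r \<in> {0<..<\<delta> / (C + 1)}) (at_right 0)"
      using \<delta>(1) \<open>C \<ge> 0\<close> by (intro eventually_at_right_real) (simp add: add_nonneg_pos)
    then show "eventually (\<lambda>r. dist (sweep (K + Z r) (w j)) (sweep K (w j)) < \<epsilon>) (at_right 0)"
    proof eventually_elim
      case (elim r)
      then have "r * (C + 1) < \<delta>" using \<open>C \<ge> 0\<close> by (simp add: field_simps)
      moreover have "r * C \<le> r * (C + 1)" using elim by (intro mult_left_mono) auto
      ultimately have "(\<Sum>i\<in>F. norm (r *\<^sub>R w i)) \<le> \<delta>"
        using elim by (simp add: C_def sum_distrib_left)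
      then have "K + Z r \<subseteq> K + cball 0 \<delta>"
        unfolding Z_def by (intro set_plus_mono2 sum_segments_subset_cball insert.hyps) auto
      then show ?case using \<delta>(2) Z by (simp add: dist_real_def)
    qed
  qed
  with insert.IH have "((\<lambda>r. sweep (K + Z r) (w j) + (vol (K + Z r) - vol K) / r)
      \<longlongrightarrow> sweep K (w j) + (\<Sum>i\<in>F. sweep K (w i))) (at_right 0)"
    unfolding Z_def by (intro tendsto_add)
  moreover have "eventually (\<lambda>r. sweep (K + Z r) (w j) + (vol (K + Z r) - vol K) / r =
      (vol (K + (\<Sum>i\<in>insert j F. closed_segment 0 (r *\<^sub>R w i))) - vol K) / r) (at_right 0)"
    using eventually_at_right_less
  proof eventually_elim
    case (elim r)
    have "K + (\<Sum>i\<in>insert j F. closed_segment 0 (r *\<^sub>R w i)) = K + Z r + closed_segment 0 (r *\<^sub>R w j)"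
      using insert.hyps by (simp add: Z_def ac_simps)
    moreover have "sweep (K + Z r) (r *\<^sub>R w j) = r * sweep (K + Z r) (w j)"
      using elim Z by (intro sweep_scaleR) auto
    ultimately show ?case
      using elim by (simp add: sweep_def field_simps)
  qed
  ultimately show ?case
    using insert.hyps by (simp add: tendsto_cong)
qed

text \<open>The sum on the right of the hypothesis is the support function of the sum of the segments, and a
compact convex set contains every point that no hyperplane separates from it.\<close>
lemma cball_subset_sum_segments:
  fixes w :: "'i \<Rightarrow> real^'n"
  assumes "finite F" and supp: "\<And>u. a * norm u \<le> (\<Sum>i\<in>F. max 0 (u \<bullet> w i))"
  shows "cball 0 a \<subseteq> (\<Sum>i\<in>F. closed_segment 0 (w i))"
proof (rule subsetI, rule ccontr)
  fix x assume x: "x \<in> cball 0 a" "x \<notin> (\<Sum>i\<in>F. closed_segment 0 (w i))"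
  obtain c b where cb: "c \<bullet> x < b" "\<And>z. z \<in> (\<Sum>i\<in>F. closed_segment 0 (w i)) \<Longrightarrow> b < c \<bullet> z"
    using separating_hyperplane_closed_point[OF convex_sum_segments[OF assms(1), of w] compact_imp_closed[OF compact_sum_segments[OF assms(1), of w]] x(2)]
    by blast
  \<comment> \<open>The vertex of the sum of segments that is extreme in the direction \<open>- c\<close>.\<close>
  define z where "z = (\<Sum>i\<in>F. if - c \<bullet> w i > 0 then w i else 0)"
  have "z \<in> (\<Sum>i\<in>F. closed_segment 0 (w i))"
    unfolding z_def using assms(1) by (auto simp: set_sum_alt)
  then have "b < c \<bullet> z" using cb(2) by blast
  have "- c \<bullet> z = (\<Sum>i\<in>F. max 0 (- c \<bullet> w i))"
    unfolding z_def inner_sum_right by (intro sum.cong) auto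
  then have "a * norm c \<le> - c \<bullet> z" using supp[of "- c"] by simp
  moreover have "- c \<bullet> x \<le> norm c * norm x"
    using norm_cauchy_schwarz[of "- c" x] by simp
  moreover have "norm c * norm x \<le> a * norm c"
    using x(1) by (simp add: mult.commute[of a] mult_left_mono)
  ultimately show False using cb(1) \<open>b < c \<bullet> z\<close> by simp
qed

lemma sum_segments_subset_cball_support:
  fixes w :: "'i \<Rightarrow> real^'n"
  assumes "finite F" "b \<ge> 0" and supp: "\<And>u. (\<Sum>i\<in>F. max 0 (u \<bullet> w i)) \<le> b * norm u"
  shows "(\<Sum>i\<in>F. closed_segment 0 (w i)) \<subseteq> cball 0 b"
proof
  fix x assume "x \<in> (\<Sum>i\<in>F. closed_segment 0 (w i))"
  then obtain s where s: "x = sum s F" "\<forall>i\<in>F. s i \<in> closed_segment 0 (w i)"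
    using assms(1) by (auto simp: set_sum_alt)
  have "x \<bullet> s i \<le> max 0 (x \<bullet> w i)" if i: "i \<in> F" for i
  proof -
    obtain t where t: "0 \<le> t" "t \<le> 1" "s i = t *\<^sub>R w i"
      using bspec[OF s(2) i] by (auto simp: in_segment)
    show ?thesis
    proof (cases "x \<bullet> w i \<ge> 0")
      case True
      then show ?thesis using t by (simp add: mult_left_le_one_le)
    next
      case False
      then show ?thesis using t by (simp add: mult_nonneg_nonpos)
    qed
  qed
  then have "(\<Sum>i\<in>F. x \<bullet> s i) \<le> (\<Sum>i\<in>F. max 0 (x \<bullet> w i))" by (rule sum_mono)
  moreover have "norm x * norm x = (\<Sum>i\<in>F. x \<bullet> s i)"
    by (simp add: s(1) flip: inner_sum_right power2_eq_square power2_norm_eq_inner)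
  ultimately have "norm x * norm x \<le> b * norm x" using supp[of x] by linarith
  then have "norm x \<le> b" using assms(2) by (cases "x = 0") auto
  then show "x \<in> cball 0 b" by simp
qed

text \<open>If sums of segments approximate the unit ball and their first variations approximate \<open>S\<close>, then \<open>S\<close> is
the first variation in the direction of the ball: volume is monotone, so the difference quotients of
the ball at the radii \<open>(1 - \<epsilon>) * r\<close> and \<open>(1 + \<epsilon>) * r\<close> enclose the one of the sum of segments at \<open>r\<close>.\<close>
lemma tendsto_ball_growth:
  fixes K :: "(real^'n) set" and S :: real
  assumes K: "compact K" "convex K"
    and approx: "\<And>\<epsilon>. 0 < \<epsilon> \<Longrightarrow> \<epsilon> < 1 \<Longrightarrow> \<exists>(F::'i set) w. finite F \<and>
      (\<forall>u. (1 - \<epsilon>) * norm u \<le> (\<Sum>i\<in>F. max 0 (u \<bullet> w i))) \<and>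
      (\<forall>u. (\<Sum>i\<in>F. max 0 (u \<bullet> w i)) \<le> (1 + \<epsilon>) * norm u) \<and>
      \<bar>(\<Sum>i\<in>F. sweep K (w i)) - S\<bar> < \<epsilon>"
  shows "((\<lambda>r. (vol (K + cball 0 r) - vol K) / r) \<longlongrightarrow> S) (at_right 0)"
proof -
  define G where "G r = (vol (K + cball 0 r) - vol K) / r" for r
  have sandwich: "eventually (\<lambda>r. (1 - \<epsilon>) * G ((1 - \<epsilon>) * r) < S + \<epsilon> \<and>
      S - \<epsilon> < (1 + \<epsilon>) * G ((1 + \<epsilon>) * r)) (at_right 0)" if \<epsilon>: "0 < \<epsilon>" "\<epsilon> < 1" for \<epsilon>
  proof -
    obtain F :: "'i set" and w where F: "finite F"
      and lo: "\<And>u. (1 - \<epsilon>) * norm u \<le> (\<Sum>i\<in>F. max 0 (u \<bullet> w i))"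
      and hi: "\<And>u. (\<Sum>i\<in>F. max 0 (u \<bullet> w i)) \<le> (1 + \<epsilon>) * norm u"
      and sw: "\<bar>(\<Sum>i\<in>F. sweep K (w i)) - S\<bar> < \<epsilon>"
      using approx[OF \<epsilon>] by blast
    define Z where "Z r = (\<Sum>i\<in>F. closed_segment 0 (r *\<^sub>R w i))" for r
    have lim: "((\<lambda>r. (vol (K + Z r) - vol K) / r) \<longlongrightarrow> (\<Sum>i\<in>F. sweep K (w i))) (at_right 0)"
      unfolding Z_def by (rule tendsto_growth_sum_segments[OF K F])
    have "eventually (\<lambda>r. (vol (K + Z r) - vol K) / r < S + \<epsilon>) (at_right 0)"
      "eventually (\<lambda>r. S - \<epsilon> < (vol (K + Z r) - vol K) / r) (at_right 0)"
      using sw by (auto intro!: order_tendstoD[OF lim])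
    then show ?thesis using eventually_at_right_less[of 0]
    proof eventually_elim
      case (elim r)
      have scale: "(\<Sum>i\<in>F. max 0 (u \<bullet> (r *\<^sub>R w i))) = r * (\<Sum>i\<in>F. max 0 (u \<bullet> w i))" for u
        using elim(3) by (auto simp: sum_distrib_left max_def zero_le_mult_iff intro!: sum.cong)
      have "cball 0 ((1 - \<epsilon>) * r) \<subseteq> Z r"
        unfolding Z_def
      proof (rule cball_subset_sum_segments[OF F])
        show "(1 - \<epsilon>) * r * norm u \<le> (\<Sum>i\<in>F. max 0 (u \<bullet> (r *\<^sub>R w i)))" for u
          unfolding scale using mult_left_mono[OF lo[of u], of r] elim(3) by (simp add: ac_simps)
      qed
      moreover have "Z r \<subseteq> cball 0 ((1 + \<epsilon>) * r)"
        unfolding Z_def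
      proof (rule sum_segments_subset_cball_support[OF F])
        show "(\<Sum>i\<in>F. max 0 (u \<bullet> (r *\<^sub>R w i))) \<le> (1 + \<epsilon>) * r * norm u" for u
          unfolding scale using mult_left_mono[OF hi[of u], of r] elim(3) by (simp add: ac_simps)
      qed (use \<epsilon> elim in auto)
      moreover have "compact (Z r)" unfolding Z_def by (rule compact_sum_segments[OF F])
      ultimately have "vol (K + cball 0 ((1 - \<epsilon>) * r)) \<le> vol (K + Z r)"
        "vol (K + Z r) \<le> vol (K + cball 0 ((1 + \<epsilon>) * r))"
        using K(1) by (simp_all add: vol_mono_compact compact_set_plus set_plus_mono2)
      then have "(1 - \<epsilon>) * G ((1 - \<epsilon>) * r) \<le> (vol (K + Z r) - vol K) / r"
        "(vol (K + Z r) - vol K) / r \<le> (1 + \<epsilon>) * G ((1 + \<epsilon>) * r)"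
        using \<epsilon> elim(3) by (auto simp: G_def divide_right_mono)
      then show ?case using elim by linarith
    qed
  qed
  have rescale: "eventually (\<lambda>r. P (r / c)) (at_right 0)"
    if "eventually P (at_right 0)" "c > 0" for P and c :: real
    by (rule eventually_compose_filterlim[OF that(1)])
      (use that(2) in \<open>auto simp: filterlim_at eventually_at_filter intro!: tendsto_eq_intros\<close>)
  have "(G \<longlongrightarrow> S) (at_right 0)"
  proof (rule order_tendstoI)
    fix a assume "a < S"
    have "((\<lambda>\<epsilon>. (S - \<epsilon>) / (1 + \<epsilon>)) \<longlongrightarrow> (S - 0) / (1 + 0)) (at_right 0)"
      by (intro tendsto_intros) auto
    then have "eventually (\<lambda>\<epsilon>. a < (S - \<epsilon>) / (1 + \<epsilon>)) (at_right 0)"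
      using \<open>a < S\<close> by (auto intro: order_tendstoD)
    then have "eventually (\<lambda>\<epsilon>. a < (S - \<epsilon>) / (1 + \<epsilon>) \<and> \<epsilon> \<in> {0<..<1}) (at_right 0)"
      by (intro eventually_conj eventually_at_right_real) auto
    then obtain \<epsilon> where \<epsilon>: "a < (S - \<epsilon>) / (1 + \<epsilon>)" "0 < \<epsilon>" "\<epsilon> < 1"
      using eventually_happens'[OF trivial_limit_at_right_real] by force
    have "eventually (\<lambda>r. S - \<epsilon> < (1 + \<epsilon>) * G ((1 + \<epsilon>) * (r / (1 + \<epsilon>)))) (at_right 0)"
      using \<epsilon> by (intro rescale eventually_mono[OF sandwich]) auto
    then show "eventually (\<lambda>r. a < G r) (at_right 0)"
    proof eventually_elim
      case (elim r)
      moreover have "(1 + \<epsilon>) * (r / (1 + \<epsilon>)) = r" using \<epsilon> by simp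
      ultimately have "(S - \<epsilon>) / (1 + \<epsilon>) < G r"
        using \<epsilon> by (simp add: pos_divide_less_eq mult.commute)
      then show ?case using \<epsilon> by simp
    qed
  next
    fix a assume "S < a"
    have "((\<lambda>\<epsilon>. (S + \<epsilon>) / (1 - \<epsilon>)) \<longlongrightarrow> (S + 0) / (1 - 0)) (at_right 0)"
      by (intro tendsto_intros) auto
    then have "eventually (\<lambda>\<epsilon>. (S + \<epsilon>) / (1 - \<epsilon>) < a) (at_right 0)"
      using \<open>S < a\<close> by (auto intro: order_tendstoD)
    then have "eventually (\<lambda>\<epsilon>. (S + \<epsilon>) / (1 - \<epsilon>) < a \<and> \<epsilon> \<in> {0<..<1}) (at_right 0)"
      by (intro eventually_conj eventually_at_right_real) auto
    then obtain \<epsilon> where \<epsilon>: "(S + \<epsilon>) / (1 - \<epsilon>) < a" "0 < \<epsilon>" "\<epsilon> < 1"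
      using eventually_happens'[OF trivial_limit_at_right_real] by force
    have "eventually (\<lambda>r. (1 - \<epsilon>) * G ((1 - \<epsilon>) * (r / (1 - \<epsilon>))) < S + \<epsilon>) (at_right 0)"
      using \<epsilon> by (intro rescale eventually_mono[OF sandwich]) auto
    then show "eventually (\<lambda>r. G r < a) (at_right 0)"
    proof eventually_elim
      case (elim r)
      moreover have "(1 - \<epsilon>) * (r / (1 - \<epsilon>)) = r" using \<epsilon> by simp
      ultimately have "G r < (S + \<epsilon>) / (1 - \<epsilon>)"
        using \<epsilon> by (simp add: pos_less_divide_eq mult.commute)
      then show ?case using \<epsilon> by simp
    qed
  qed
  then show ?thesis by (simp add: G_def[abs_def])
qed

section \<open>Surface area as an integral of swept volumes\<close>

text \<open>One finite quadrature rule has to serve all directions \<open>u\<close> of a support function and the function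
\<open>sweep K\<close> simultaneously. The error depends on the integrand only through its modulus of continuity, so the
nodes can be chosen first. They are the tags of a fine tagged division, weighted by the integral of
\<open>\<phi>\<close> over the cell.\<close>
lemma ex_quadrature:
  fixes \<phi> :: "real^'n \<Rightarrow> real"
  assumes \<phi>: "continuous_on UNIV \<phi>" "\<And>x. \<phi> x \<ge> 0" "\<And>x. norm x > R \<Longrightarrow> \<phi> x = 0"
    and "\<delta> > 0"
  shows "\<exists>(F :: ((real^'n) \<times> (real^'n) set) set) l. finite F \<and> (\<forall>i\<in>F. l i \<ge> 0) \<and>
    (\<forall>f \<eta>. continuous_on UNIV f \<longrightarrow> (\<forall>x y. dist x y < \<delta> \<longrightarrow> \<bar>f x - f y\<bar> \<le> \<eta>) \<longrightarrow>
       \<bar>(\<Sum>i\<in>F. l i * f (fst i)) - integral UNIV (\<lambda>x. \<phi> x * f x)\<bar> \<le> \<eta> * integral UNIV \<phi>)"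
proof -
  obtain a where a: "cball (0::real^'n) R \<subseteq> cbox (-a) a"
    using bounded_subset_cbox_symmetric[OF bounded_cball] by blast
  have "gauge (\<lambda>x::real^'n. ball x \<delta>)" using \<open>\<delta> > 0\<close> by (simp add: gauge_ball)
  then obtain p where p: "p tagged_division_of cbox (-a) a" "(\<lambda>x. ball x \<delta>) fine p"
    using fine_division_exists by blast
  define l where "l i = integral (snd i) \<phi>" for i :: "(real^'n) \<times> (real^'n) set"
  have int: "f integrable_on k" if "continuous_on UNIV f" "(x, k) \<in> p" for f :: "real^'n \<Rightarrow> real" and x k
    using tagged_division_ofD(4)[OF p(1) that(2)] that(1)
    by (auto intro!: integrable_continuous intro: continuous_on_subset)
  have split: "integral UNIV g = (\<Sum>i\<in>p. integral (snd i) g)"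
    if "continuous_on UNIV g" "\<And>x. norm x > R \<Longrightarrow> g x = 0" for g :: "real^'n \<Rightarrow> real"
  proof -
    have "integral UNIV g = integral (cbox (-a) a) g"
      using that a by (rule integral_compact_support_cbox)
    also have "\<dots> = (\<Sum>(x, k)\<in>p. integral k g)"
      by (intro integral_combine_tagged_division_topdown[OF _ p(1)] integrable_continuous
          continuous_on_subset[OF that(1)]) auto
    finally show ?thesis by (simp add: case_prod_beta)
  qed
  show ?thesis
  proof (intro exI conjI ballI allI impI)
    show "finite p" using p(1) by (rule tagged_division_of_finite)
    show "l i \<ge> 0" if "i \<in> p" for i
      using int[OF \<phi>(1), of "fst i" "snd i"] that \<phi>(2) by (auto simp: l_def intro!: integral_nonneg)
    fix f :: "real^'n \<Rightarrow> real" and \<eta>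
    assume f: "continuous_on UNIV f" and osc: "\<forall>x y. dist x y < \<delta> \<longrightarrow> \<bar>f x - f y\<bar> \<le> \<eta>"
    have piece: "\<bar>l i * f (fst i) - integral (snd i) (\<lambda>x. \<phi> x * f x)\<bar> \<le> \<eta> * integral (snd i) \<phi>"
      if i: "i \<in> p" for i
    proof -
      obtain x k where ik: "i = (x, k)" "(x, k) \<in> p" using i by (cases i) auto
      have sub: "k \<subseteq> ball x \<delta>" using p(2) ik(2) by (auto simp: fine_def)
      have i\<phi>: "\<phi> integrable_on k" using int[OF \<phi>(1) ik(2)] .
      have i\<phi>f: "(\<lambda>y. \<phi> y * f y) integrable_on k"
        using ik(2) \<phi>(1) f by (intro int continuous_intros)
      have "l i * f (fst i) - integral (snd i) (\<lambda>x. \<phi> x * f x)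
          = integral k (\<lambda>y. \<phi> y * f x) - integral k (\<lambda>y. \<phi> y * f y)"
        using ik(1) by (simp add: l_def)
      also have "\<dots> = integral k (\<lambda>y. \<phi> y * f x - \<phi> y * f y)"
        using i\<phi> i\<phi>f by (intro integral_diff[symmetric] integrable_on_mult_left)
      also have "\<bar>\<dots>\<bar> \<le> integral k (\<lambda>y. \<eta> * \<phi> y)"
        unfolding real_norm_def[symmetric]
      proof (rule integral_norm_bound_integral)
        show "(\<lambda>y. \<phi> y * f x - \<phi> y * f y) integrable_on k"
          using i\<phi> i\<phi>f by (intro integrable_diff integrable_on_mult_left)
        show "(\<lambda>y. \<eta> * \<phi> y) integrable_on k" using i\<phi> by (rule integrable_on_mult_right)
        fix y assume "y \<in> k"
        then have "\<bar>f x - f y\<bar> \<le> \<eta>" using sub osc by auto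
        then have "\<phi> y * \<bar>f x - f y\<bar> \<le> \<phi> y * \<eta>" using \<phi>(2) by (rule mult_left_mono)
        then show "norm (\<phi> y * f x - \<phi> y * f y) \<le> \<eta> * \<phi> y"
          using \<phi>(2)[of y] by (simp add: abs_mult ac_simps flip: right_diff_distrib)
      qed
      finally show ?thesis using ik by simp
    qed
    have "\<bar>(\<Sum>i\<in>p. l i * f (fst i)) - integral UNIV (\<lambda>x. \<phi> x * f x)\<bar>
        = \<bar>\<Sum>i\<in>p. l i * f (fst i) - integral (snd i) (\<lambda>x. \<phi> x * f x)\<bar>"
      using \<phi> f by (subst split) (auto simp: sum_subtractf intro!: continuous_intros)
    also have "\<dots> \<le> (\<Sum>i\<in>p. \<eta> * integral (snd i) \<phi>)"
      by (rule order_trans[OF sum_abs sum_mono[OF piece]])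
    also have "\<dots> = \<eta> * integral UNIV \<phi>"
      using split[OF \<phi>(1,3)] by (simp add: sum_distrib_left)
    finally show "\<bar>(\<Sum>i\<in>p. l i * f (fst i)) - integral UNIV (\<lambda>x. \<phi> x * f x)\<bar> \<le> \<eta> * integral UNIV \<phi>" .
  qed
qed

lemma integral_pos_compact_support:
  fixes g :: "'a::euclidean_space \<Rightarrow> real"
  assumes "continuous_on UNIV g" "\<And>x. g x \<ge> 0" "\<And>x. norm x > R \<Longrightarrow> g x = 0" "g y > 0"
  shows "integral UNIV g > 0"
proof -
  obtain a where a: "cball (0::'a) (max R 1) \<subseteq> cbox (-a) a"
    using bounded_subset_cbox_symmetric[OF bounded_cball] by blast
  have R: "norm x > max R 1 \<Longrightarrow> g x = 0" for x using assms(3) by simp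
  have "norm y \<le> max R 1" using R[of y] assms(4) by force
  then have y: "y \<in> cbox (-a) a" using a by auto
  have "ball 0 1 \<subseteq> interior (cbox (-a) a)"
    by (rule interior_maximal) (use a in auto)
  then have "box (-a) a \<noteq> {}" by (auto simp: interior_cbox)
  then have "integral (cbox (-a) a) g \<noteq> 0"
    using integral_cbox_eq_0_iff[of "-a" a g] assms y
    by (metis continuous_on_subset less_irrefl top_greatest)
  moreover have "integral (cbox (-a) a) g \<ge> 0"
    using assms by (intro integral_nonneg integrable_continuous) (auto intro: continuous_on_subset)
  ultimately show ?thesis
    using integral_compact_support_cbox[OF assms(1) R a] by simp
qed

text \<open>Any nonnegative radial weight of positive mass would represent the ball as an average of segments. This one is
compactly supported, so that uniform continuity suffices, and continuously differentiable, so that one can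
differentiate under the integral sign.\<close>
definition bump :: "real^'n \<Rightarrow> real" where
  "bump x = (max 0 (1 - (norm x)\<^sup>2))\<^sup>2"

lemma bump_nonneg: "bump x \<ge> 0"
  by (simp add: bump_def)

lemma bump_eq_0: "norm x > 1 \<Longrightarrow> bump x = 0"
  by (simp add: bump_def max_def power_le_one_iff not_less)

lemma continuous_bump: "continuous_on UNIV bump"
  unfolding bump_def by (intro continuous_intros)

text \<open>The left-hand side is rotation invariant and positively homogeneous in \<open>u\<close>, which leaves a multiple
of the norm. In terms of support functions: the average of the segments from \<open>0\<close> to \<open>x\<close>, weighted by
\<open>bump x\<close>, is a ball.\<close>
lemma ex_bump_moment:
  "\<exists>\<kappa>>0. \<forall>u::real^'n. integral UNIV (\<lambda>x. bump x * max 0 (u \<bullet> x)) = \<kappa> * norm u"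
proof -
  define J where "J u = integral UNIV (\<lambda>x::real^'n. bump x * max 0 (u \<bullet> x))" for u
  define e :: "real^'n" where "e = axis undefined 1"
  have e: "norm e = 1" by (simp add: e_def)
  have cont: "continuous_on UNIV (\<lambda>x. bump x * max 0 (u \<bullet> x))" for u :: "real^'n"
    by (intro continuous_intros continuous_bump)
  have supp: "norm x > 1 \<Longrightarrow> bump x * max 0 (u \<bullet> x) = 0" for u x :: "real^'n"
    by (simp add: bump_eq_0)
  have scale: "J (r *\<^sub>R u) = r * J u" if "r \<ge> 0" for r u
  proof -
    have "bump x * max 0 ((r *\<^sub>R u) \<bullet> x) = r * (bump x * max 0 (u \<bullet> x))" for x
      using that by (auto simp: max_def zero_le_mult_iff)
    then show ?thesis unfolding J_def by (simp only: integral_mult_right)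
  qed
  have "J u = J e" if u: "norm u = 1" for u
  proof -
    obtain f :: "real^'n \<Rightarrow> real^'n" where f: "orthogonal_transformation f" "f e = u"
      using orthogonal_transformation_exists[of e u] e u by metis
    have "J u = integral UNIV (\<lambda>x. bump (f x) * max 0 (u \<bullet> f x))"
      unfolding J_def
      using integral_scales_volume[OF scales_volume_orthogonal[OF f(1)] cont supp] by simp
    also have "\<dots> = J e"
      using f unfolding J_def
      by (simp add: bump_def orthogonal_transformation_norm f(2)[symmetric] del: f(2))
        (simp add: orthogonal_transformation_def)
    finally show ?thesis .
  qed
  then have "J u = J e * norm u" for u
    using scale[of "norm u" "u /\<^sub>R norm u"] scale[of 0 0] by (cases "u = 0") (auto simp: mult.commute)
  moreover have "J e > 0"
    unfolding J_def
  proof (rule integral_pos_compact_support[OF cont _ supp])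
    show "0 < bump (e /\<^sub>R 2) * max 0 (e \<bullet> (e /\<^sub>R 2))"
      using e by (simp add: bump_def power2_eq_square dot_square_norm)
  qed (auto simp: bump_nonneg)
  ultimately show ?thesis unfolding J_def by blast
qed

text \<open>The ball is a weighted average of segments, the first variation of volume is additive on segments,
and its value on the segment from \<open>0\<close> to \<open>x\<close> is \<open>sweep K x\<close>. (This is a form of Cauchy's surface area formula.) In
particular the limit that defines \<^const>\<open>surf\<close> exists.\<close>
theorem ex_surf_eq_integral_sweep:
  "\<exists>\<kappa>>0. \<forall>K::(real^'n) set. compact K \<longrightarrow> convex K \<longrightarrow>
     surf K = \<kappa> * integral UNIV (\<lambda>x. bump x * sweep K x)"
proof -
  obtain \<kappa> where \<kappa>: "\<kappa> > 0"
    "\<And>u::real^'n. integral UNIV (\<lambda>x. bump x * max 0 (u \<bullet> x)) = \<kappa> * norm u"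
    using ex_bump_moment by blast
  have "surf K = inverse \<kappa> * integral UNIV (\<lambda>x. bump x * sweep K x)"
    if K: "compact K" "convex K" for K :: "(real^'n) set"
  proof -
    define I where "I = integral UNIV (bump :: real^'n \<Rightarrow> real)"
    define S where "S = inverse \<kappa> * integral UNIV (\<lambda>x. bump x * sweep K x)"
    have "I \<ge> 0" unfolding I_def
      by (intro integral_nonneg integrable_on_lborel bump_nonneg
          integrable_compact_support[OF continuous_bump bump_eq_0])
    have "((\<lambda>r. (vol (K + cball 0 r) - vol K) / r) \<longlongrightarrow> S) (at_right 0)"
    proof (rule tendsto_ball_growth[OF K])
      fix \<epsilon> :: real assume \<epsilon>: "0 < \<epsilon>" "\<epsilon> < 1"
      define \<eta> where "\<eta> = \<epsilon> * \<kappa> / (I + 1)"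
      have \<eta>: "\<eta> > 0" "\<eta> * I < \<epsilon> * \<kappa>"
        using \<epsilon> \<kappa>(1) \<open>I \<ge> 0\<close> by (auto simp: \<eta>_def field_simps)
      obtain \<delta>1 where \<delta>1: "\<delta>1 > 0" "\<And>x y. dist x y < \<delta>1 \<Longrightarrow> dist (sweep K x) (sweep K y) < \<eta>"
        using uniformly_continuous_sweep[OF K] \<eta>(1) unfolding uniformly_continuous_on_def
        by (metis UNIV_I)
      define \<delta> where "\<delta> = min \<delta>1 \<eta>"
      have "\<delta> > 0" using \<delta>1(1) \<eta>(1) by (simp add: \<delta>_def)
      have "\<exists>(F :: ((real^'n) \<times> (real^'n) set) set) l. finite F \<and> (\<forall>i\<in>F. l i \<ge> 0) \<and>
          (\<forall>f \<eta>. continuous_on UNIV f \<longrightarrow> (\<forall>x y. dist x y < \<delta> \<longrightarrow> \<bar>f x - f y\<bar> \<le> \<eta>) \<longrightarrow>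
          \<bar>(\<Sum>i\<in>F. l i * f (fst i)) - integral UNIV (\<lambda>x. bump x * f x)\<bar> \<le> \<eta> * I)"
        unfolding I_def
        by (rule ex_quadrature[OF continuous_bump bump_nonneg _ \<open>\<delta> > 0\<close>]) (rule bump_eq_0)
      then obtain F :: "((real^'n) \<times> (real^'n) set) set" and l
        where F: "finite F" "\<And>i. i \<in> F \<Longrightarrow> l i \<ge> 0"
        and quad: "\<And>f \<eta>. continuous_on UNIV f \<Longrightarrow> (\<forall>x y. dist x y < \<delta> \<longrightarrow> \<bar>f x - f y\<bar> \<le> \<eta>) \<Longrightarrow>
          \<bar>(\<Sum>i\<in>F. l i * f (fst i)) - integral UNIV (\<lambda>x. bump x * f x)\<bar> \<le> \<eta> * I"
        by blast
      define w where "w i = (inverse \<kappa> * l i) *\<^sub>R fst i" for i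
      have sw: "\<bar>(\<Sum>i\<in>F. sweep K (w i)) - S\<bar> < \<epsilon>"
      proof -
        have "\<bar>(\<Sum>i\<in>F. l i * sweep K (fst i)) - integral UNIV (\<lambda>x. bump x * sweep K x)\<bar> \<le> \<eta> * I"
          using \<delta>1(2) uniformly_continuous_imp_continuous[OF uniformly_continuous_sweep[OF K]]
          by (intro quad) (auto simp: \<delta>_def dist_real_def less_imp_le)
        also have "\<dots> < \<epsilon> * \<kappa>" by (rule \<eta>(2))
        finally have "inverse \<kappa> * \<bar>(\<Sum>i\<in>F. l i * sweep K (fst i)) - integral UNIV (\<lambda>x. bump x * sweep K x)\<bar> < \<epsilon>"
          using \<kappa>(1) by (simp add: field_simps)
        moreover have "(\<Sum>i\<in>F. sweep K (w i)) = inverse \<kappa> * (\<Sum>i\<in>F. l i * sweep K (fst i))"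
          using F(2) \<kappa>(1) by (simp add: w_def sweep_scaleR[OF K] sum_distrib_left mult.assoc)
        ultimately show ?thesis
          using \<kappa>(1) by (simp add: S_def abs_mult flip: right_diff_distrib)
      qed
      have ball: "\<bar>(\<Sum>i\<in>F. max 0 (u \<bullet> w i)) - norm u\<bar> \<le> \<epsilon> * norm u" for u
      proof -
        have "\<bar>(\<Sum>i\<in>F. l i * max 0 (u \<bullet> fst i)) - integral UNIV (\<lambda>x. bump x * max 0 (u \<bullet> x))\<bar>
            \<le> (norm u * \<eta>) * I"
        proof (intro quad allI impI)
          fix x y :: "real^'n" assume "dist x y < \<delta>"
          have "\<bar>max 0 (u \<bullet> x) - max 0 (u \<bullet> y)\<bar> \<le> \<bar>u \<bullet> (x - y)\<bar>"
            by (simp add: inner_diff_right max_def abs_if)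
          also have "\<dots> \<le> norm u * norm (x - y)" by (rule Cauchy_Schwarz_ineq2)
          also have "\<dots> \<le> norm u * \<eta>"
            using \<open>dist x y < \<delta>\<close> by (intro mult_left_mono) (auto simp: \<delta>_def dist_norm)
          finally show "\<bar>max 0 (u \<bullet> x) - max 0 (u \<bullet> y)\<bar> \<le> norm u * \<eta>" .
        qed (intro continuous_intros)
        also have "\<dots> \<le> norm u * (\<epsilon> * \<kappa>)"
          using \<eta>(2) by (simp add: mult.assoc mult_left_mono)
        finally have "inverse \<kappa> * \<bar>(\<Sum>i\<in>F. l i * max 0 (u \<bullet> fst i)) - \<kappa> * norm u\<bar> \<le> \<epsilon> * norm u"
          using \<kappa> by (simp add: field_simps)
        moreover have "(\<Sum>i\<in>F. max 0 (u \<bullet> w i)) = inverse \<kappa> * (\<Sum>i\<in>F. l i * max 0 (u \<bullet> fst i))"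
          unfolding sum_distrib_left
        proof (rule sum.cong[OF refl])
          fix i assume "i \<in> F"
          then have "inverse \<kappa> * l i \<ge> 0" using F(2) \<kappa>(1) by simp
          then show "max 0 (u \<bullet> w i) = inverse \<kappa> * (l i * max 0 (u \<bullet> fst i))"
            unfolding w_def mult.assoc[symmetric] inner_scaleR_right
            by (metis max_mult_distrib_left mult_zero_right)
        qed
        moreover have "inverse \<kappa> * (\<kappa> * norm u) = norm u" using \<kappa>(1) by simp
        ultimately show ?thesis
          using \<kappa>(1) by (simp add: abs_mult_pos' right_diff_distrib)
      qed
      have "(1 - \<epsilon>) * norm u \<le> (\<Sum>i\<in>F. max 0 (u \<bullet> w i)) \<and> (\<Sum>i\<in>F. max 0 (u \<bullet> w i)) \<le> (1 + \<epsilon>) * norm u" for u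
        using ball[of u] by (simp add: abs_le_iff algebra_simps)
      then show "\<exists>(F::((real^'n) \<times> (real^'n) set) set) w. finite F \<and>
          (\<forall>u. (1 - \<epsilon>) * norm u \<le> (\<Sum>i\<in>F. max 0 (u \<bullet> w i))) \<and>
          (\<forall>u. (\<Sum>i\<in>F. max 0 (u \<bullet> w i)) \<le> (1 + \<epsilon>) * norm u) \<and>
          \<bar>(\<Sum>i\<in>F. sweep K (w i)) - S\<bar> < \<epsilon>"
        using F(1) sw by blast
    qed
    moreover have "parallel_body K r = K + cball 0 r" for r
      unfolding parallel_body_def set_plus_def by blast
    ultimately show ?thesis
      unfolding surf_def S_def by (simp add: tendsto_Lim)
  qed
  then show ?thesis using \<kappa>(1) by (metis inverse_positive_iff_positive)
qed

section \<open>The derivative under orthogonal affinities\<close>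
lemma has_real_derivative_max0_sq:
  "((\<lambda>y::real. (max 0 y)\<^sup>2) has_real_derivative 2 * max 0 y) (at y)"
proof -
  consider "y > 0" | "y < 0" | "y = 0" by linarith
  then show ?thesis
  proof cases
    case 1
    have "((\<lambda>y::real. y\<^sup>2) has_real_derivative 2 * y) (at y)"
      by (auto intro!: derivative_eq_intros)
    then show ?thesis
      by (rule has_field_derivative_transform_within_open[of _ _ _ "{0<..}", THEN DERIV_cong]) (use 1 in auto)
  next
    case 2
    have "((\<lambda>y::real. 0) has_real_derivative 0) (at y)" by simp
    then show ?thesis
      by (rule has_field_derivative_transform_within_open[of _ _ _ "{..<0}", THEN DERIV_cong]) (use 2 in auto)
  next
    case 3
    have "((\<lambda>h::real. (max 0 h)\<^sup>2 / h) \<longlongrightarrow> 0) (at 0)"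
    proof (rule Lim_null_comparison)
      show "eventually (\<lambda>h. norm ((max 0 h)\<^sup>2 / h) \<le> \<bar>h\<bar>) (at (0::real))"
        by (rule eventually_mono[OF eventually_True]) (auto simp: max_def power2_eq_square)
      show "((\<lambda>h::real. \<bar>h\<bar>) \<longlongrightarrow> 0) (at 0)" by (auto intro!: tendsto_eq_intros)
    qed
    then show ?thesis using 3 by (simp add: DERIV_def)
  qed
qed

text \<open>Twice the derivative of \<open>(max 0 (1 - s))\<^sup>2\<close> at \<open>s = (norm x)\<^sup>2\<close>; the factor two comes from the derivative of
\<open>t\<^sup>2\<close> at \<open>1\<close>.\<close>
definition bump_slope :: "real^'n \<Rightarrow> real" where
  "bump_slope x = - 4 * max 0 (1 - (norm x)\<^sup>2)"

text \<open>All the dependence on \<open>t\<close> sits in the smooth weight, so \<open>p\<close> may be merely continuous. With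
\<open>q x = (x \<bullet> v)\<^sup>2\<close> this is the derivative of the surface area integral along the affinity with axis \<open>v\<close>; with
\<open>q x = (norm x)\<^sup>2\<close> it is the derivative along dilations, which gives the trace.\<close>
lemma integral_stretched_bump_deriv:
  fixes p q :: "real^'n \<Rightarrow> real"
  assumes p: "continuous_on UNIV p" and q: "continuous_on UNIV q" "\<And>x. 0 \<le> q x" "\<And>x. q x \<le> (norm x)\<^sup>2"
  shows "((\<lambda>t. integral UNIV (\<lambda>x. (max 0 (1 - ((norm x)\<^sup>2 + (t\<^sup>2 - 1) * q x)))\<^sup>2 * p x))
           has_real_derivative integral UNIV (\<lambda>x. bump_slope x * q x * p x)) (at 1)"
proof -
  define g where "g t x = (max 0 (1 - ((norm x)\<^sup>2 + (t\<^sup>2 - 1) * q x)))\<^sup>2 * p x" for t x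
  define g' where "g' t x = - 4 * t * max 0 (1 - ((norm x)\<^sup>2 + (t\<^sup>2 - 1) * q x)) * q x * p x" for t x
  obtain a where a: "cball (0::real^'n) 2 \<subseteq> cbox (-a) a"
    using bounded_subset_cbox_symmetric[OF bounded_cball] by blast
  define U where "U = {1/2<..<2::real}"
  \<comment> \<open>For \<open>t > 1/2\<close> the quadratic form in the weight is at least a quarter of the square of the norm.\<close>
  have far: "max 0 (1 - ((norm x)\<^sup>2 + (t\<^sup>2 - 1) * q x)) = 0" if "t \<in> U" "norm x > 2" for t x
  proof -
    have "t\<^sup>2 \<ge> (1/2)\<^sup>2" using that(1) by (intro power_mono) (auto simp: U_def)
    then have "(t\<^sup>2 - 1) * q x \<ge> (- 3/4) * q x" using q(2) by (intro mult_right_mono) (auto simp: power2_eq_square)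
    moreover have "(norm x)\<^sup>2 \<ge> 2\<^sup>2" using that(2) by (intro power_mono) auto
    ultimately show ?thesis using q(3)[of x] by simp
  qed
  have cont_g: "continuous_on S (g t)" for S t
    unfolding g_def by (intro continuous_intros continuous_on_subset[OF q(1)] continuous_on_subset[OF p]) auto
  have cont_g1: "continuous_on S (g' 1)" for S
    unfolding g'_def by (intro continuous_intros continuous_on_subset[OF q(1)] continuous_on_subset[OF p]) auto
  have "((\<lambda>t. integral (cbox (-a) a) (g t)) has_real_derivative integral (cbox (-a) a) (g' 1)) (at 1 within U)"
  proof (rule leibniz_rule_field_derivative)
    fix t x assume "t \<in> U"
    show "((\<lambda>t. g t x) has_real_derivative g' t x) (at t within U)"
      unfolding g_def g'_def
      by (rule derivative_eq_intros DERIV_chain'[OF _ has_real_derivative_max0_sq] refl)+ simp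
  next
    show "g t integrable_on cbox (-a) a" for t by (intro integrable_continuous cont_g)
    show "continuous_on (U \<times> cbox (- a) a) (\<lambda>(x, t). g' x t)"
      unfolding g'_def case_prod_beta
      by (intro continuous_intros continuous_on_compose2[OF q(1)] continuous_on_compose2[OF p]) auto
  qed (auto simp: U_def)
  then have "((\<lambda>t. integral (cbox (-a) a) (g t)) has_real_derivative integral (cbox (-a) a) (g' 1)) (at 1)"
    by (subst (asm) at_within_open) (auto simp: U_def)
  moreover have "integral UNIV (g t) = integral (cbox (-a) a) (g t)" if "t \<in> U" for t
    by (rule integral_compact_support_cbox[OF cont_g _ a]) (simp add: g_def far[OF that])
  moreover have "integral UNIV (g' 1) = integral (cbox (-a) a) (g' 1)"
  proof (rule integral_compact_support_cbox[OF cont_g1 _ a])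
    show "g' 1 x = 0" if "norm x > 2" for x using far[of 1 x] that by (simp add: g'_def U_def)
  qed
  ultimately have "((\<lambda>t. integral UNIV (g t)) has_real_derivative integral UNIV (g' 1)) (at 1)"
    by (auto intro: has_field_derivative_transform_within_open[of _ _ _ U] simp: U_def)
  moreover have "g' 1 = (\<lambda>x. bump_slope x * q x * p x)"
    by (simp add: g'_def bump_slope_def fun_eq_iff)
  ultimately show ?thesis by (simp add: g_def[abs_def])
qed

text \<open>Euler's relation for homogeneous functions, in integrated form: substituting \<open>t *\<^sub>R x\<close> shows that the integral
against the dilated weight is a multiple of the power of \<open>t\<close> with exponent \<open>- (n + 1)\<close>, and both sides are its
derivative at \<open>1\<close>.\<close>
lemma integral_bump_slope_homogeneous:
  fixes p :: "real^'n \<Rightarrow> real"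
  assumes p: "continuous_on UNIV p" and hom: "\<And>r x. r \<ge> 0 \<Longrightarrow> p (r *\<^sub>R x) = r * p x"
  shows "integral UNIV (\<lambda>x. bump_slope x * (norm x)\<^sup>2 * p x)
    = - (real CARD('n) + 1) * integral UNIV (\<lambda>x. bump x * p x)"
proof -
  define J where "J = integral UNIV (\<lambda>x. bump x * p x)"
  have bump_scaled: "(max 0 (1 - ((norm x)\<^sup>2 + (t\<^sup>2 - 1) * (norm x)\<^sup>2)))\<^sup>2 = bump (t *\<^sub>R x)" for t and x :: "real^'n"
    by (simp add: bump_def power_mult_distrib algebra_simps)
  have scaled: "integral UNIV (\<lambda>x. bump (t *\<^sub>R x) * p x) = t powi (- int (CARD('n) + 1)) * J" if "t > 0" for t
  proof -
    have "J = t ^ CARD('n) * integral UNIV (\<lambda>x. bump (t *\<^sub>R x) * p (t *\<^sub>R x))"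
      unfolding J_def
      by (rule integral_scales_volume[OF scales_volume_scaleR[OF that], where R=1])
        (auto intro!: continuous_intros continuous_bump p simp: bump_eq_0)
    also have "\<dots> = t ^ (CARD('n) + 1) * integral UNIV (\<lambda>x. bump (t *\<^sub>R x) * p x)"
    proof -
      have "(\<lambda>x. bump (t *\<^sub>R x) * p (t *\<^sub>R x)) = (\<lambda>x. t * (bump (t *\<^sub>R x) * p x))"
        using that by (simp add: hom fun_eq_iff)
      then show ?thesis by simp
    qed
    finally show ?thesis using that by (simp add: power_int_minus field_simps del: power_Suc flip: of_nat_Suc)
  qed
  have "((\<lambda>t. integral UNIV (\<lambda>x. bump (t *\<^sub>R x) * p x)) has_real_derivative
      integral UNIV (\<lambda>x. bump_slope x * (norm x)\<^sup>2 * p x)) (at 1)"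
    using integral_stretched_bump_deriv[OF p, of "\<lambda>x. (norm x)\<^sup>2"]
    by (simp add: bump_scaled continuous_intros)
  moreover have "((\<lambda>t. t powi (- int (CARD('n) + 1)) * J) has_real_derivative - (real CARD('n) + 1) * J) (at 1)"
    by (auto intro!: derivative_eq_intros)
  then have "((\<lambda>t. integral UNIV (\<lambda>x. bump (t *\<^sub>R x) * p x)) has_real_derivative - (real CARD('n) + 1) * J) (at 1)"
    by (rule has_field_derivative_transform_within_open[of _ _ _ "{0<..}"]) (auto simp: scaled)
  ultimately show ?thesis unfolding J_def by (rule DERIV_unique)
qed

section \<open>Orthonormal bases that equalise a quadratic form\<close>

text \<open>If \<open>Q (e i) < m < Q (e j)\<close>, rotate the pair \<open>e i\<close>, \<open>e j\<close> in its plane until the form takes the value \<open>m\<close> at the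
first vector, which happens by the intermediate value theorem. The trace does not change, and the number of
vectors with a value other than \<open>m\<close> drops.\<close>
lemma ex_orthonormal_equalising:
  fixes Q :: "'a::real_inner \<Rightarrow> real" and e :: "'n::finite \<Rightarrow> 'a"
  assumes quad: "\<And>u w. \<exists>b. \<forall>c s. Q (c *\<^sub>R u + s *\<^sub>R w) = c\<^sup>2 * Q u + 2 * c * s * b + s\<^sup>2 * Q w"
    and on: "\<forall>i j. e i \<bullet> e j = (if i = j then 1 else 0)"
    and mean: "(\<Sum>i\<in>UNIV. Q (e i)) = real CARD('n) * m"
  shows "\<exists>e' :: 'n \<Rightarrow> 'a. (\<forall>i j. e' i \<bullet> e' j = (if i = j then 1 else 0)) \<and> (\<forall>i. Q (e' i) = m)"
  using on mean
proof (induction "card {i. Q (e i) \<noteq> m}" arbitrary: e rule: less_induct)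
  case less
  show ?case
  proof (cases "\<forall>i. Q (e i) = m")
    case True
    then show ?thesis using less.prems by blast
  next
    case False
    have sum0: "(\<Sum>i\<in>UNIV. Q (e i) - m) = 0" using less.prems(2) by (simp add: sum_subtractf)
    have "\<exists>i. Q (e i) < m"
    proof (rule ccontr)
      assume "\<not> (\<exists>i. Q (e i) < m)"
      then have "\<forall>i\<in>UNIV. Q (e i) - m = 0"
        using sum0 by (subst (asm) sum_nonneg_eq_0_iff) (auto simp: not_less)
      then show False using False by simp
    qed
    then obtain i where i: "Q (e i) < m" by blast
    have "\<exists>j. Q (e j) > m"
    proof (rule ccontr)
      assume "\<not> (\<exists>j. Q (e j) > m)"
      then have "\<forall>i\<in>UNIV. m - Q (e i) = 0"
        using sum0 by (subst sum_nonneg_eq_0_iff[symmetric]) (auto simp: not_less sum_subtractf)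
      then show False using False by simp
    qed
    then obtain j where j: "Q (e j) > m" by blast
    have ij: "i \<noteq> j" using i j by auto
    obtain b where b: "\<And>c s. Q (c *\<^sub>R e i + s *\<^sub>R e j) = c\<^sup>2 * Q (e i) + 2 * c * s * b + s\<^sup>2 * Q (e j)"
      using quad by blast
    define g where "g \<theta> = Q (cos \<theta> *\<^sub>R e i + sin \<theta> *\<^sub>R e j)" for \<theta>
    have "continuous_on {0..pi/2} g" unfolding g_def b by (intro continuous_intros)
    moreover have "g 0 \<le> m" "m \<le> g (pi/2)" using i j by (auto simp: g_def)
    ultimately obtain \<theta> where \<theta>: "g \<theta> = m" using IVT'[of g 0 m "pi/2"] by auto
    define u where "u = cos \<theta> *\<^sub>R e i + sin \<theta> *\<^sub>R e j"
    define w where "w = (- sin \<theta>) *\<^sub>R e i + cos \<theta> *\<^sub>R e j"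
    define e' where "e' = e(i := u, j := w)"
    have Qu: "Q u = m" using \<theta> by (simp add: g_def u_def)
    have trace: "Q u + Q w = Q (e i) + Q (e j)"
    proof -
      have "Q u + Q w = ((cos \<theta>)\<^sup>2 + (sin \<theta>)\<^sup>2) * (Q (e i) + Q (e j))"
        unfolding u_def w_def b by algebra
      then show ?thesis by simp
    qed
    have inner_e: "e k \<bullet> e l = (if k = l then 1 else 0)" for k l using less.prems(1) by blast
    have on': "\<forall>k l. e' k \<bullet> e' l = (if k = l then 1 else 0)"
      using ij sin_cos_squared_add[of \<theta>] sin_cos_squared_add2[of \<theta>]
      by (auto simp: e'_def u_def w_def inner_add_left inner_add_right inner_diff_left inner_diff_right
          inner_e power2_eq_square)
    have split: "(\<Sum>k\<in>UNIV. f k) = f i + f j + (\<Sum>k\<in>UNIV - {i, j}. f k)" for f :: "'n \<Rightarrow> real"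
      using sum.subset_diff[of "{i, j}" UNIV f] ij by simp
    have "(\<Sum>k\<in>UNIV. Q (e' k)) = (\<Sum>k\<in>UNIV. Q (e k))"
      unfolding split using ij trace by (simp add: e'_def)
    then have mean': "(\<Sum>k\<in>UNIV. Q (e' k)) = real CARD('n) * m" using less.prems(2) by simp
    have "Q (e k) \<noteq> m" if "Q (e' k) \<noteq> m" for k
    proof (cases "k = i \<or> k = j")
      case True
      then show ?thesis using i j by auto
    next
      case False
      then show ?thesis using that by (simp add: e'_def)
    qed
    moreover have "Q (e' i) = m" "Q (e i) \<noteq> m"
      using i ij Qu by (simp_all add: e'_def)
    ultimately have "{k. Q (e' k) \<noteq> m} \<subset> {k. Q (e k) \<noteq> m}" by blast
    then have "card {k. Q (e' k) \<noteq> m} < card {k. Q (e k) \<noteq> m}"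
      by (simp add: psubset_card_mono)
    then show ?thesis using less.hyps on' mean' by blast
  qed
qed

lemma span_orthonormal:
  fixes e :: "'n::finite \<Rightarrow> real^'n"
  assumes on: "\<forall>i j. e i \<bullet> e j = (if i = j then 1 else 0)"
  shows "span (range e) = UNIV"
proof -
  have "inj e" using on by (metis injI zero_neq_one)
  have "independent (range e)"
  proof (rule pairwise_orthogonal_independent)
    show "pairwise orthogonal (range e)"
      using on by (auto simp: pairwise_def orthogonal_def)
    show "0 \<notin> range e" using on by (metis imageE inner_zero_left zero_neq_one)
  qed
  then have "dim (range e) = DIM(real^'n)"
    using \<open>inj e\<close> by (simp add: dim_eq_card_independent card_image)
  then show ?thesis using dim_eq_full by blast
qed

section \<open>Critical directions of the isoperimetric ratio\<close>

text \<open>For a linear map \<open>A\<close> of volume factor \<open>t\<close> one has \<open>sweep (A ` K) (A x) = t * sweep K x\<close>, and the substitution \<open>A x\<close> in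
the integral brings in \<open>t\<close> once more. The body \<open>K\<close> stays fixed in the resulting integral and \<open>A\<close>
acts on the weight only.\<close>
lemma surf_stretch:
  fixes K :: "(real^'n) set"
  assumes \<kappa>: "\<And>L::(real^'n) set. compact L \<Longrightarrow> convex L \<Longrightarrow> surf L = \<kappa> * integral UNIV (\<lambda>x. bump x * sweep L x)"
    and K: "compact K" "convex K" and v: "norm v = 1" and t: "t > 0"
  shows "surf (stretch K v t) = \<kappa> * (t\<^sup>2 *
      integral UNIV (\<lambda>x. (max 0 (1 - ((norm x)\<^sup>2 + (t\<^sup>2 - 1) * (x \<bullet> v)\<^sup>2)))\<^sup>2 * sweep K x))"
    and "vol (stretch K v t) = t * vol K"
proof -
  define A where "A x = x + ((t - 1) * (x \<bullet> v)) *\<^sub>R v" for x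
  define a where "a = - ((t - 1) * (center_of_mass K \<bullet> v)) *\<^sub>R v"
  have sv: "scales_volume A t"
    using scales_volume_axial[OF v t] by (simp add: A_def[abs_def])
  then have linA: "linear A" by (simp add: scales_volume_def)
  have st: "stretch K v t = (+) a ` A ` K"
    unfolding stretch_def image_image
    by (intro image_cong) (auto simp: orthogonal_affinity_def A_def a_def algebra_simps inner_diff_left)
  have AK: "compact (A ` K)" "convex (A ` K)"
    using K linA by (auto intro!: compact_continuous_image linear_continuous_on convex_linear_image simp: linear_linear)
  then have "compact (stretch K v t)" "convex (stretch K v t)"
    by (simp_all add: st compact_translation convex_translation)
  then have "surf (stretch K v t) = \<kappa> * integral UNIV (\<lambda>x. bump x * sweep (A ` K) x)"
    using \<kappa> by (simp add: st sweep_translation)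
  also have "integral UNIV (\<lambda>x. bump x * sweep (A ` K) x)
      = t * integral UNIV (\<lambda>x. bump (A x) * sweep (A ` K) (A x))"
    using uniformly_continuous_imp_continuous[OF uniformly_continuous_sweep[OF AK]]
    by (intro integral_scales_volume[OF sv, where R=1]) (auto intro!: continuous_intros continuous_bump simp: bump_eq_0)
  also have "\<dots> = t\<^sup>2 * integral UNIV (\<lambda>x. bump (A x) * sweep K x)"
  proof -
    have "(\<lambda>x. bump (A x) * sweep (A ` K) (A x)) = (\<lambda>x. t * (bump (A x) * sweep K x))"
      by (simp add: sweep_linear_image[OF sv K(1)] fun_eq_iff)
    then show ?thesis by (simp add: power2_eq_square)
  qed
  also have "(\<lambda>x. bump (A x) * sweep K x)
      = (\<lambda>x. (max 0 (1 - ((norm x)\<^sup>2 + (t\<^sup>2 - 1) * (x \<bullet> v)\<^sup>2)))\<^sup>2 * sweep K x)"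
  proof -
    have "v \<bullet> v = 1" using v by (simp add: dot_square_norm)
    then have shifted: "(norm (x + k *\<^sub>R v))\<^sup>2 = (norm x)\<^sup>2 + 2 * k * (x \<bullet> v) + k\<^sup>2" for x k
      unfolding power2_norm_eq_inner
      by (simp add: inner_add_left inner_add_right inner_commute[of v x] power2_eq_square algebra_simps)
    have "(norm (A x))\<^sup>2 = (norm x)\<^sup>2 + (t\<^sup>2 - 1) * (x \<bullet> v)\<^sup>2" for x
      unfolding A_def shifted by algebra
    then show ?thesis by (simp add: bump_def)
  qed
  finally show "surf (stretch K v t) = \<kappa> * (t\<^sup>2 *
      integral UNIV (\<lambda>x. (max 0 (1 - ((norm x)\<^sup>2 + (t\<^sup>2 - 1) * (x \<bullet> v)\<^sup>2)))\<^sup>2 * sweep K x))" .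
  show "vol (stretch K v t) = t * vol K"
    using sv K(1) by (simp add: st measure_translation scales_volume_def lmeasurable_compact)
qed

theorem theorem7:
  fixes K :: "(real ^ 'n) set"
  assumes "CARD('n) \<ge> 2"
    and "convex_body K"
    and "C_k_boundary 3 K"
  shows "\<exists>e :: 'n \<Rightarrow> real ^ 'n.
    (\<forall>i j. e i \<bullet> e j = (if i = j then 1 else 0)) \<and>
    span (range e) = UNIV \<and>
    (\<forall>i. ((\<lambda>t. isoperimetric_ratio (stretch K (e i) t)) has_real_derivative 0) (at 1))"
proof -
  have K: "compact K" "convex K" "interior K \<noteq> {}"
    using assms(2) by (auto simp: convex_body_def)
  have volK: "vol K > 0"
  proof -
    have "\<not> negligible K" using K by (simp add: negligible_convex_interior)
    then show ?thesis
      using K(1) by (simp add: negligible_iff_measure lmeasurable_compact zero_less_measure_iff)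
  qed
  obtain \<kappa> where \<kappa>: "\<kappa> > 0"
    "\<And>L::(real^'n) set. compact L \<Longrightarrow> convex L \<Longrightarrow> surf L = \<kappa> * integral UNIV (\<lambda>x. bump x * sweep L x)"
    using ex_surf_eq_integral_sweep by blast
  define n where "n = real CARD('n)"
  have n: "n \<ge> 2" using assms(1) by (simp add: n_def)
  define p where "p = sweep K"
  have cont_p: "continuous_on UNIV p"
    unfolding p_def using uniformly_continuous_imp_continuous[OF uniformly_continuous_sweep[OF K(1,2)]] .
  define J where "J = integral UNIV (\<lambda>x. bump x * p x)"
  have "J > 0"
    unfolding J_def
  proof (rule integral_pos_compact_support)
    define y :: "real^'n" where "y = (1/2) *\<^sub>R axis undefined 1"
    have "norm y = 1/2" by (simp add: y_def)
    then have "(norm y)\<^sup>2 = (1/2)\<^sup>2" "y \<noteq> 0" by (simp only:, auto)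
    then have "bump y > 0" by (simp add: bump_def power_divide)
    then show "0 < bump y * p y"
      using sweep_pos[OF K(1,2) volK \<open>y \<noteq> 0\<close>] by (simp add: p_def)
    show "bump x * p x = 0" if "norm x > 1" for x using that by (simp add: bump_eq_0)
    show "continuous_on UNIV (\<lambda>x. bump x * p x)"
      by (intro continuous_on_mult continuous_bump cont_p)
    show "bump x * p x \<ge> 0" for x
      using bump_nonneg[of x] sweep_nonneg[OF K(1), of x] by (simp add: p_def)
  qed
  define \<psi> where "\<psi> x = bump_slope x * p x" for x
  have cont_\<psi>: "continuous_on UNIV \<psi>"
    unfolding \<psi>_def bump_slope_def by (intro continuous_intros cont_p)
  have int: "(\<lambda>x. \<psi> x * f x) integrable_on UNIV" if "continuous_on UNIV f" for f
  proof (intro integrable_on_lborel integrable_compact_support)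
    show "\<psi> x * f x = 0" if "norm x > 1" for x
      using that by (simp add: \<psi>_def bump_slope_def power_le_one_iff not_less max_def)
  qed (intro continuous_intros cont_\<psi> that)
  define Q where "Q v = integral UNIV (\<lambda>x. \<psi> x * (x \<bullet> v)\<^sup>2)" for v
  \<comment> \<open>The logarithmic derivative of the ratio along \<open>v\<close> vanishes exactly for one value of this
    quadratic form, and homogeneity shows that this value is its trace divided by \<open>n\<close>.\<close>
  have quad: "\<exists>b. \<forall>c s. Q (c *\<^sub>R u + s *\<^sub>R w) = c\<^sup>2 * Q u + 2 * c * s * b + s\<^sup>2 * Q w" for u w
  proof (intro exI allI)
    fix c s :: real
    define b where "b = integral UNIV (\<lambda>x. \<psi> x * ((x \<bullet> u) * (x \<bullet> w)))"
    have "Q (c *\<^sub>R u + s *\<^sub>R w) = integral UNIV (\<lambda>x. c\<^sup>2 * (\<psi> x * (x \<bullet> u)\<^sup>2)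
        + 2 * c * s * (\<psi> x * ((x \<bullet> u) * (x \<bullet> w))) + s\<^sup>2 * (\<psi> x * (x \<bullet> w)\<^sup>2))"
      unfolding Q_def
      by (intro arg_cong[of _ _ "integral UNIV"]) (auto simp: inner_add_right power2_eq_square algebra_simps)
    also have "\<dots> = c\<^sup>2 * Q u + 2 * c * s * b + s\<^sup>2 * Q w"
      unfolding Q_def b_def
      by (intro integral_unique has_integral_add has_integral_mult_right integrable_integral int
          continuous_intros)
    finally show "Q (c *\<^sub>R u + s *\<^sub>R w) = c\<^sup>2 * Q u
        + 2 * c * s * integral UNIV (\<lambda>x. \<psi> x * ((x \<bullet> u) * (x \<bullet> w))) + s\<^sup>2 * Q w"
      unfolding b_def .
  qed
  have trace: "(\<Sum>i\<in>UNIV. Q (axis i 1)) = - (n + 1) * J"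
  proof -
    have norm_sq: "(norm x)\<^sup>2 = (\<Sum>i\<in>UNIV. (x \<bullet> axis i 1)\<^sup>2)" for x :: "real^'n"
      by (simp add: norm_vec_def L2_set_def inner_axis sum_nonneg)
    have "(\<Sum>i\<in>UNIV. Q (axis i 1)) = integral UNIV (\<lambda>x. \<Sum>i\<in>UNIV. \<psi> x * (x \<bullet> axis i 1)\<^sup>2)"
    proof -
      have "(\<lambda>x. \<psi> x * (x \<bullet> axis i 1)\<^sup>2) integrable_on UNIV" for i
        by (intro int continuous_intros)
      then show ?thesis unfolding Q_def by (simp add: integral_sum)
    qed
    also have "\<dots> = integral UNIV (\<lambda>x. bump_slope x * (norm x)\<^sup>2 * p x)"
      by (intro arg_cong[of _ _ "integral UNIV"])
        (simp add: \<psi>_def norm_sq sum_distrib_left sum_distrib_right mult_ac)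
    also have "\<dots> = - (n + 1) * J"
      unfolding n_def J_def
      by (rule integral_bump_slope_homogeneous[OF cont_p]) (simp add: p_def sweep_scaleR[OF K(1,2)])
    finally show ?thesis .
  qed
  have "\<exists>e :: 'n \<Rightarrow> real^'n. (\<forall>i j. e i \<bullet> e j = (if i = j then 1 else 0)) \<and>
      (\<forall>i. Q (e i) = - (n + 1) * J / n)"
  proof (rule ex_orthonormal_equalising[OF quad])
    show "\<forall>i j. (axis i 1 :: real^'n) \<bullet> axis j 1 = (if i = j then 1 else 0)"
      by (simp add: inner_axis_axis)
    show "(\<Sum>i\<in>UNIV. Q (axis i 1)) = real CARD('n) * (- (n + 1) * J / n)"
      using trace n by (simp add: n_def)
  qed
  then obtain e :: "'n \<Rightarrow> real^'n" where on: "\<forall>i j. e i \<bullet> e j = (if i = j then 1 else 0)"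
    and Qe: "\<And>i. Q (e i) = - (n + 1) * J / n"
    by blast
  have "((\<lambda>t. isoperimetric_ratio (stretch K (e i) t)) has_real_derivative 0) (at 1)" for i
  proof -
    define v where "v = e i"
    have v: "norm v = 1" using on by (simp add: v_def norm_eq_1)
    define H where "H t = integral UNIV (\<lambda>x. (max 0 (1 - ((norm x)\<^sup>2 + (t\<^sup>2 - 1) * (x \<bullet> v)\<^sup>2)))\<^sup>2 * p x)" for t
    have le: "(x \<bullet> v)\<^sup>2 \<le> (norm x)\<^sup>2" for x
      using Cauchy_Schwarz_ineq2[of x v] v by (metis abs_le_square_iff abs_norm_cancel mult.right_neutral)
    have "(H has_real_derivative integral UNIV (\<lambda>x. bump_slope x * (x \<bullet> v)\<^sup>2 * p x)) (at 1)"
      unfolding H_def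
      by (rule integral_stretched_bump_deriv[OF cont_p]) (auto intro!: continuous_intros le)
    also have "integral UNIV (\<lambda>x. bump_slope x * (x \<bullet> v)\<^sup>2 * p x) = - (n + 1) * J / n"
      using Qe[of i] by (simp add: Q_def \<psi>_def v_def mult_ac)
    finally have H': "(H has_real_derivative - (n + 1) * J / n) (at 1)" .
    have H1: "H 1 = J" by (simp add: H_def J_def bump_def)
    define \<alpha> where "\<alpha> = n / (n - 1)"
    define C where "C = surf (cball (0::real^'n) 1) powr \<alpha> / vol (cball (0::real^'n) 1)"
    define S where "S t = \<kappa> * (t\<^sup>2 * H t)" for t
    have S1: "S 1 = \<kappa> * J" "S 1 > 0" using \<kappa>(1) \<open>J > 0\<close> by (auto simp: S_def H1)
    have S': "(S has_real_derivative \<kappa> * J * (n - 1) / n) (at 1)"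
    proof -
      have "(S has_real_derivative \<kappa> * (2 * H 1 + (- (n + 1) * J / n))) (at 1)"
        unfolding S_def by (auto intro!: derivative_eq_intros H')
      also have "\<kappa> * (2 * H 1 + (- (n + 1) * J / n)) = \<kappa> * J * (n - 1) / n"
        using n by (simp add: H1 field_simps)
      finally show ?thesis .
    qed
    have quot: "((\<lambda>t. t * vol K / S t powr \<alpha> * C) has_real_derivative
        ((vol K * S 1 powr \<alpha> - vol K * (\<alpha> * S 1 powr (\<alpha> - 1) * (\<kappa> * J * (n - 1) / n)))
          / (S 1 powr \<alpha> * S 1 powr \<alpha>)) * C) (at 1)"
      using S1(2) by (auto intro!: derivative_eq_intros S' simp: algebra_simps)
    have "\<alpha> * S 1 powr (\<alpha> - 1) * (\<kappa> * J * (n - 1) / n) = S 1 powr \<alpha>"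
    proof -
      have key: "\<alpha> * (\<kappa> * J * (n - 1) / n) = S 1" using n by (simp add: \<alpha>_def S1(1))
      have "\<alpha> * S 1 powr (\<alpha> - 1) * (\<kappa> * J * (n - 1) / n)
          = S 1 powr (\<alpha> - 1) * (\<alpha> * (\<kappa> * J * (n - 1) / n))"
        by (simp only: mult_ac)
      also have "\<dots> = S 1 powr (\<alpha> - 1) * S 1" by (simp only: key)
      also have "\<dots> = S 1 powr \<alpha>" using S1(2) by (simp add: powr_diff)
      finally show ?thesis .
    qed
    with quot have "((\<lambda>t. t * vol K / S t powr \<alpha> * C) has_real_derivative 0) (at 1)"
      by (simp only: diff_self div_0 mult_zero_left)
    then show ?thesis
    proof (rule has_field_derivative_transform_within_open[of _ _ _ "{0<..}"])
      fix t :: real assume "t \<in> {0<..}"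
      then have "surf (stretch K v t) = S t" "vol (stretch K v t) = t * vol K"
        using surf_stretch[OF \<kappa>(2) K(1,2) v, of t] unfolding S_def H_def p_def by auto
      then show "t * vol K / S t powr \<alpha> * C = isoperimetric_ratio (stretch K (e i) t)"
        unfolding v_def[symmetric] isoperimetric_ratio_def Let_def C_def \<alpha>_def n_def by simp
    qed auto
  qed
  then show ?thesis using on span_orthonormal[OF on] by blast
qed

end
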